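(* Let $G$ be a connected simple graph with maximum degree $\Delta$ and minimum degree $\delta\geq 2$. Then $D'(G)\leq 1+\lceil \sqrt{\Delta}\rceil$.
   Context: The distinguishing index $D'(G)$ of a graph $G$ is the least number $d$ such that there is a labeling of the edges of $G$ with $d$ labels that is preserved only by the identity automorphism of $G$. *)

theory Defs
  imports Complex_Main
begin

text \<open>
  A graph is given by its vertex set \<open>V\<close> and its edge set \<open>E\<close>, whose members are
  two-element subsets of \<open>V\<close>.
\<close>

definition finite_simple_graph :: "'a set \<Rightarrow> 'a set set \<Rightarrow> bool" where
  "finite_simple_graph V E \<longleftrightarrow> finite V \<and> (\<forall>e\<in>E. e \<subseteq> V \<and> card e = 2)"

definition connected_graph :: "'a set \<Rightarrow> 'a set set \<Rightarrow> bool" where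
  "connected_graph V E \<longleftrightarrow>
     V \<noteq> {} \<and> (\<forall>u\<in>V. \<forall>v\<in>V. (u, v) \<in> {(x, y). {x, y} \<in> E}\<^sup>*)"

definition vertex_degree :: "'a set set \<Rightarrow> 'a \<Rightarrow> nat" where
  "vertex_degree E v = card {e \<in> E. v \<in> e}"

definition max_degree :: "'a set \<Rightarrow> 'a set set \<Rightarrow> nat" where
  "max_degree V E = Max (vertex_degree E ` V)"

definition min_degree :: "'a set \<Rightarrow> 'a set set \<Rightarrow> nat" where
  "min_degree V E = Min (vertex_degree E ` V)"

text \<open>
  Automorphisms are total functions on the type of vertices. Only their values on \<open>V\<close>
  matter, so the identity automorphism is any \<open>f\<close> with \<open>f v = v\<close> for all \<open>v \<in> V\<close>.
\<close>

definition graph_automorphism :: "'a set \<Rightarrow> 'a set set \<Rightarrow> ('a \<Rightarrow> 'a) \<Rightarrow> bool" where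
  "graph_automorphism V E f \<longleftrightarrow>
     bij_betw f V V \<and> (\<forall>u\<in>V. \<forall>v\<in>V. {f u, f v} \<in> E \<longleftrightarrow> {u, v} \<in> E)"

definition preserves_labeling :: "'a set set \<Rightarrow> ('a set \<Rightarrow> 'b) \<Rightarrow> ('a \<Rightarrow> 'a) \<Rightarrow> bool" where
  "preserves_labeling E c f \<longleftrightarrow> (\<forall>e\<in>E. c (f ` e) = c e)"

definition distinguishing_labeling :: "'a set \<Rightarrow> 'a set set \<Rightarrow> ('a set \<Rightarrow> 'b) \<Rightarrow> bool" where
  "distinguishing_labeling V E c \<longleftrightarrow>
     (\<forall>f. graph_automorphism V E f \<and> preserves_labeling E c f \<longrightarrow> (\<forall>v\<in>V. f v = v))"

text \<open>
  The labels are \<open>0, \<dots>, d - 1\<close>, and not all of them need to be used. If no edge labeling is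
  distinguishing (as for the complete graph on two vertices), the value is unspecified. A connected
  graph with at least three vertices always has one: label the edges injectively.
\<close>

definition distinguishing_index :: "'a set \<Rightarrow> 'a set set \<Rightarrow> nat" where
  "distinguishing_index V E =
     (LEAST d. \<exists>c :: 'a set \<Rightarrow> nat. c ` E \<subseteq> {..<d} \<and> distinguishing_labeling V E c)"

end

theory Submission
  imports Defs
begin

text \<open>
  Let \<open>k = \<lceil>sqrt \<Delta>\<rceil>\<close>. The labels are the residues modulo \<open>k + 1\<close>, and the sum of the labels at a
  vertex is an invariant of every label-preserving automorphism. Starting from a root \<open>r\<close> of maximum
  degree we grow a set \<open>S\<close> of vertices that are fixed by every label-preserving automorphism fixing
  \<open>r\<close>. In each step we choose \<open>v\<close> in \<open>S\<close> with a minimal nonempty set \<open>C\<close> of neighbours outside \<open>S\<close>;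
  then the vertices of \<open>S\<close> that get their last label are exactly those with the same set \<open>C\<close>.
  If there is another such vertex \<open>s\<close>, the elements \<open>u\<close> of \<open>C\<close> are separated by the pair of labels
  of \<open>vu\<close> and \<open>su\<close>. Otherwise they are separated by the pair of the label of \<open>vu\<close> and the sum at
  \<open>u\<close>, which is why the minimum degree has to be at least two. The root is made recognizable by its
  sum; the graphs in which \<open>r\<close> and another vertex are both adjacent to all the remaining vertices
  are treated separately.
\<close>

section \<open>Choosing residues\<close>

text \<open>New vertices with the same label at \<open>v\<close> form a row, and a row is separated
  only later, by the final sums of its members; so rows must be short enough to leave admissible
  residues. A vertex \<open>v\<close> other than the root has at most
  \<open>k\<^sup>2 - 1 = (k - 1) * (k + 1)\<close> new neighbours. Rows of \<open>k - 1\<close> can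
  therefore hold them, which leaves two admissible residues even when \<open>\<rho>\<close> is
  excluded. The root may have \<open>k\<^sup>2\<close> neighbours; label 0 is kept as a mark there,
  so the rows have size \<open>k\<close> and only one residue is sure to be left. Sums are adjusted
  by alternating a correction along a walk up to a vertex whose sum does not matter. The obstacle is
  a component of the graph on \<open>C\<close> that can be left only through \<open>v\<close>: one
  vertex in it has no prescribable sum. Such a vertex gets a label at \<open>v\<close> that the
  other vertices of these components do not use, and it is pinned down by a neighbour that is
  already fixed. It should not have maximum degree, since otherwise it might have to avoid
  \<open>\<rho>\<close>; this is what brings in the exceptional graphs at the root.\<close>

lemma greedy_choice:
  fixes F :: "'a \<Rightarrow> int set"
  assumes "finite P"
    and "\<And>u. u \<in> P \<Longrightarrow> finite (F u) \<and> card (F u) + card (K u \<inter> P - {u}) < n"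
    and "\<And>u u'. u \<in> P \<Longrightarrow> u' \<in> P \<Longrightarrow> u' \<in> K u \<Longrightarrow> u \<in> K u'"
  shows "\<exists>g. \<forall>u\<in>P. g u \<in> {0..<int n} \<and> g u \<notin> F u \<and> (\<forall>u'\<in>K u \<inter> P. u' \<noteq> u \<longrightarrow> g u \<noteq> g u')"
  using assms
proof (induction P rule: finite_induct)
  case empty
  then show ?case by simp
next
  case (insert x P)
  have "card (F u) + card (K u \<inter> P - {u}) < n" if "u \<in> P" for u
  proof -
    have "card (K u \<inter> P - {u}) \<le> card (K u \<inter> insert x P - {u})"
      using insert.hyps by (intro card_mono) auto
    then show ?thesis using insert.prems(1)[of u] that by fastforce
  qed
  then obtain g where g: "\<forall>u\<in>P. g u \<in> {0..<int n} \<and> g u \<notin> F u \<and> (\<forall>u'\<in>K u \<inter> P. u' \<noteq> u \<longrightarrow> g u \<noteq> g u')"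
    using insert.IH insert.prems by (metis insertCI)
  have "card (F x \<union> g ` (K x \<inter> P)) \<le> card (F x) + card (K x \<inter> P)"
    using insert.hyps by (meson card_Un_le card_image_le finite_Int add_left_mono le_trans)
  also have "K x \<inter> P = K x \<inter> insert x P - {x}" using insert.hyps by auto
  also have "card (F x) + card (K x \<inter> insert x P - {x}) < n" using insert.prems(1)[of x] by simp
  finally have "card (F x \<union> g ` (K x \<inter> P)) < card {0..<int n}" by (simp add: \<open>K x \<inter> P = _\<close>)
  moreover have "finite (F x \<union> g ` (K x \<inter> P))" using insert.prems(1)[of x] insert.hyps by simp
  ultimately have "\<not> {0..<int n} \<subseteq> F x \<union> g ` (K x \<inter> P)"
    using card_mono[of "F x \<union> g ` (K x \<inter> P)" "{0..<int n}"] by linarith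
  then obtain y where y: "y \<in> {0..<int n}" "y \<notin> F x \<union> g ` (K x \<inter> P)" by blast
  have sym: "u \<in> P \<Longrightarrow> x \<in> K u \<Longrightarrow> u \<in> K x" for u using insert.prems(2)[of u x] by simp
  have "\<forall>u\<in>insert x P. (g(x := y)) u \<in> {0..<int n} \<and> (g(x := y)) u \<notin> F u \<and>
     (\<forall>u'\<in>K u \<inter> insert x P. u' \<noteq> u \<longrightarrow> (g(x := y)) u \<noteq> (g(x := y)) u')"
  proof
    fix u assume u: "u \<in> insert x P"
    show "(g(x := y)) u \<in> {0..<int n} \<and> (g(x := y)) u \<notin> F u \<and>
     (\<forall>u'\<in>K u \<inter> insert x P. u' \<noteq> u \<longrightarrow> (g(x := y)) u \<noteq> (g(x := y)) u')"
    proof (cases "u = x")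
      case True
      then show ?thesis using y by auto
    next
      case False
      then have "u \<in> P" using u by simp
      then show ?thesis using g y sym[of u] False by auto
    qed
  qed
  then show ?case by blast
qed

lemma card_mod_class_le:
  fixes n :: nat
  assumes "n > 0" "\<And>i. i < m \<Longrightarrow> i mod n = j \<Longrightarrow> i < q * n"
  shows "card {i. i < m \<and> i mod n = j} \<le> q"
proof -
  have "inj_on (\<lambda>i. i div n) {i. i < m \<and> i mod n = j}"
    by (rule inj_onI) (metis (mono_tags, lifting) div_mult_mod_eq mem_Collect_eq)
  moreover have "(\<lambda>i. i div n) ` {i. i < m \<and> i mod n = j} \<subseteq> {..<q}"
    using assms by (auto simp: less_mult_imp_div_less)
  ultimately show ?thesis
    by (metis card_inj_on_le card_lessThan finite_lessThan)
qed

lemma card_fun_upd_class_le: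
  assumes "finite I"
  shows "card {i \<in> I. (f(i0 := y)) i = j} \<le> card {i \<in> I. f i = j} + of_bool (j = y)"
proof -
  have "{i \<in> I. (f(i0 := y)) i = j} \<subseteq> {i \<in> I. f i = j} \<union> (if j = y then {i0} else {})" by auto
  then have "card {i \<in> I. (f(i0 := y)) i = j} \<le> card ({i \<in> I. f i = j} \<union> (if j = y then {i0} else {}))"
    using assms by (intro card_mono) auto
  also have "\<dots> \<le> card {i \<in> I. f i = j} + card (if j = y then {i0} else {})" by (rule card_Un_le)
  also have "card (if j = y then {i0} else {}) = of_bool (j = y)" by simp
  finally show ?thesis .
qed

lemma sum_fun_upd_int:
  fixes f :: "'a \<Rightarrow> nat"
  assumes "finite I" "i0 \<in> I"
  shows "int (\<Sum>i\<in>I. (f(i0 := y)) i) = int (\<Sum>i\<in>I. f i) - int (f i0) + int y"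
proof -
  have "(\<Sum>i\<in>I. (f(i0 := y)) i) = y + (\<Sum>i\<in>I - {i0}. f i)"
    using assms by (simp add: sum.remove)
  moreover have "(\<Sum>i\<in>I. f i) = f i0 + (\<Sum>i\<in>I - {i0}. f i)" using assms by (simp add: sum.remove)
  ultimately show ?thesis by simp
qed

text \<open>The round-robin values \<open>i mod n\<close> already have rows of at most
  \<open>k - 1\<close>; changing one entry corrects the sum. If all rows are full, one of them must
  grow to \<open>k\<close>. It is the row of 0, because an edge labeled 0 to a vertex of maximum
  degree removes the need to avoid \<open>\<rho>\<close>.\<close>

lemma balanced_values_index:
  fixes X :: int
  assumes k: "k \<ge> 2" and m: "1 \<le> m" "m \<le> k\<^sup>2 - 1"
  obtains a :: "nat \<Rightarrow> nat" where "\<And>i. i < m \<Longrightarrow> a i \<le> k" "int (\<Sum>i<m. a i) mod (int k + 1) = X mod (int k + 1)"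
    "\<And>j. card {i \<in> {..<m}. a i = j} \<le> k - 1 \<or> j = 0 \<and> m = k\<^sup>2 - 1 \<and> card {i \<in> {..<m}. a i = j} \<le> k"
proof -
  note outer = that
  define n where "n = k + 1"
  have n: "n \<ge> 3" "n > 0" "int n = int k + 1" using k by (auto simp: n_def)
  have kk: "k\<^sup>2 - 1 = (k - 1) * n"
    by (simp add: n_def power2_eq_square algebra_simps)
  define b :: "nat \<Rightarrow> nat" where "b i = i mod n" for i
  define d where "d = nat ((X - int (\<Sum>i<m. b i)) mod int n)"
  have d: "d < n" "int d mod int n = (X - int (\<Sum>i<m. b i)) mod int n"
  proof -
    have "0 \<le> (X - int (\<Sum>i<m. b i)) mod int n" "(X - int (\<Sum>i<m. b i)) mod int n < int n"
      using n(2) by (auto simp del: of_nat_sum)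
    then show "d < n" "int d mod int n = (X - int (\<Sum>i<m. b i)) mod int n" unfolding d_def by (linarith, simp del: of_nat_sum)
  qed
  have b_le: "b i \<le> k" for i using n mod_less_divisor[of n i] unfolding b_def n_def by linarith
  have fin: "finite {..<m}" by simp
  have cnt: "card {i \<in> {..<m}. b i = j} \<le> q" if "\<And>i. i < m \<Longrightarrow> i mod n = j \<Longrightarrow> i < q * n" for j q
    using card_mod_class_le[of n m j q] n that by (simp add: b_def)
  have cnt_all: "card {i \<in> {..<m}. b i = j} \<le> k - 1" for j
    using m kk by (intro cnt) auto
  show ?thesis
  proof (cases "d = 0")
    case True
    then have "(X - int (\<Sum>i<m. b i)) mod int n = 0" using d by simp
    then have "int (\<Sum>i<m. b i) mod (int k + 1) = X mod (int k + 1)"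
      unfolding n(3) by (metis mod_eq_dvd_iff mod_0_imp_dvd)
    then show ?thesis using b_le cnt_all by (intro that[of b]) auto
  next
    case dn: False
    have upd: ?thesis if i0: "i0 < m" and y: "y \<le> k" and
        s: "(int y - int (b i0)) mod int n = int d mod int n" and
        r: "card {i \<in> {..<m}. b i = y} \<le> k - 2 \<or> y = 0 \<and> m = k\<^sup>2 - 1" for i0 y
    proof (rule outer[of "b(i0 := y)"])
      show "(b(i0 := y)) i \<le> k" for i using y b_le by simp
      have "int (\<Sum>i<m. (b(i0 := y)) i) mod int n = (int (\<Sum>i<m. b i) + (int y - int (b i0))) mod int n"
        by (subst sum_fun_upd_int) (use i0 in \<open>simp_all add: algebra_simps\<close>)
      also have "\<dots> = (int (\<Sum>i<m. b i) + int d) mod int n" using s by (metis mod_add_right_eq)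
      also have "\<dots> = (int (\<Sum>i<m. b i) + (X - int (\<Sum>i<m. b i))) mod int n" using d(2) by (metis mod_add_right_eq)
      finally show "int (\<Sum>i<m. (b(i0 := y)) i) mod (int k + 1) = X mod (int k + 1)" using n by simp
      fix j
      have "card {i \<in> {..<m}. (b(i0 := y)) i = j} \<le> card {i \<in> {..<m}. b i = j} + of_bool (j = y)"
        by (rule card_fun_upd_class_le) simp
      then show "card {i \<in> {..<m}. (b(i0 := y)) i = j} \<le> k - 1 \<or>
        j = 0 \<and> m = k\<^sup>2 - 1 \<and> card {i \<in> {..<m}. (b(i0 := y)) i = j} \<le> k"
        using r cnt_all[of j] k by (cases "j = y") (auto simp del: fun_upd_apply)
    qed
    show ?thesis
    proof (cases "m = k\<^sup>2 - 1")
      case True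
      \<comment> \<open>All rows are full here: raising the value \<open>n - d\<close> by
        \<open>d\<close> gives 0 modulo \<open>n\<close>, the one row that may overflow. The bound
        \<open>m \<ge> n\<close> ensures that the index \<open>n - d\<close> exists.\<close>
      have "1 * n \<le> (k - 1) * n" by (rule mult_le_mono1) (use k in linarith)
      then have "m \<ge> n" using True kk by simp
      moreover have "(int 0 - int (b (n - d))) mod int n = int d mod int n"
      proof -
        have "b (n - d) = n - d" using d dn n by (simp add: b_def)
        then have "int 0 - int (b (n - d)) = int d + (-1) * int n" using d by simp
        then show ?thesis by (metis mod_mult_self1)
      qed
      ultimately show ?thesis using upd[of "n - d" 0] dn True n by simp
    next
      case False
      define q where "q = m div n"
      define p where "p = m mod n"
      have mqp: "m = q * n + p" "p < n" using n by (auto simp: q_def p_def)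
      have "m < (k - 1) * n" using False m kk by simp
      then have qk: "q \<le> k - 2" unfolding q_def using less_mult_imp_div_less[of m "k-1" n] by linarith
      \<comment> \<open>Only residues below \<open>p\<close> occur in the incomplete last round, so
        the other rows have \<open>q \<le> k - 2\<close> entries and can take one more.\<close>
      have low: "card {i \<in> {..<m}. b i = y} \<le> k - 2" if "y \<ge> p" for y
      proof -
        have "card {i \<in> {..<m}. b i = y} \<le> q"
        proof (rule cnt, rule ccontr)
          fix i assume i: "i < m" "i mod n = y" "\<not> i < q * n"
          then have "i - q * n < p" using mqp by simp
          moreover have "i mod n = (i - q * n) mod n" using i(3)
            by (metis mod_mult_self3 not_less le_add_diff_inverse)
          ultimately show False using i(2) that mqp(2) by simp
        qed
        then show ?thesis using qk by simp
      qed
      show ?thesis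
      proof (cases "p = 0")
        case True
        then show ?thesis using upd[of 0 d] low[of d] m d n by (simp add: b_def n_def)
      next
        case False
        \<comment> \<open>Truncated subtraction: the new value \<open>x + d\<close> is
          \<open>p\<close> if \<open>d \<le> p\<close>, and \<open>d\<close> otherwise. In both
          cases its row has room, and the entry with value \<open>x\<close> in the last round is the
          one to change.\<close>
        define x where "x = p - d"
        have x: "x < p" "x + d \<ge> p" "x + d < n" using False dn d mqp unfolding x_def by auto
        have "b (q * n + x) = x" using x mqp by (simp add: b_def)
        then show ?thesis using upd[of "q * n + x" "x + d"] low[of "x + d"] x mqp n_def by simp
      qed
    qed
  qed
qed

lemma finite_enumeration:
  assumes "finite U"
  obtains h where "bij_betw h U {..<card U}" "\<And>f :: nat \<Rightarrow> 'c::comm_monoid_add. (\<Sum>u\<in>U. f (h u)) = (\<Sum>i<card U. f i)"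
    "\<And>Q. card {u \<in> U. Q (h u)} = card {i \<in> {..<card U}. Q i}"
proof -
  obtain h where h: "bij_betw h U {0..<card U}" using ex_bij_betw_finite_nat[OF assms] by blast
  then have h: "bij_betw h U {..<card U}" by (simp add: atLeast0LessThan)
  have "card {u \<in> U. Q (h u)} = card {i \<in> {..<card U}. Q i}" for Q
  proof -
    have "bij_betw h {u \<in> U. Q (h u)} {i \<in> {..<card U}. Q i}"
      using h unfolding bij_betw_def by (auto intro: inj_on_subset)
    then show ?thesis by (rule bij_betw_same_card)
  qed
  then show ?thesis using that[of h] h sum.reindex_bij_betw[OF h] by blast
qed

lemma balanced_values:
  fixes X :: int
  assumes "k \<ge> 2" "finite U" "U \<noteq> {}" "card U \<le> k\<^sup>2 - 1"
  shows "\<exists>a :: 'a \<Rightarrow> int. (\<forall>u\<in>U. a u \<in> {0..<int k + 1}) \<and> (\<Sum>u\<in>U. a u) mod (int k + 1) = X mod (int k + 1) \<and>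
    (\<forall>j. card {u \<in> U. a u = j} \<le> k - 1 \<or> j = 0 \<and> card U = k\<^sup>2 - 1 \<and> card {u \<in> U. a u = j} \<le> k)"
proof -
  obtain h where h: "bij_betw h U {..<card U}" "\<And>f :: nat \<Rightarrow> int. (\<Sum>u\<in>U. f (h u)) = (\<Sum>i<card U. f i)"
    "\<And>Q. card {u \<in> U. Q (h u)} = card {i \<in> {..<card U}. Q i}"
    using finite_enumeration[OF assms(2), where 'c = int] by metis
  have "1 \<le> card U" using assms by (simp add: Suc_leI card_gt_0_iff)
  then obtain a :: "nat \<Rightarrow> nat" where a: "\<And>i. i < card U \<Longrightarrow> a i \<le> k"
    "int (\<Sum>i<card U. a i) mod (int k + 1) = X mod (int k + 1)"
    "\<And>j. card {i \<in> {..<card U}. a i = j} \<le> k - 1 \<or> j = 0 \<and> card U = k\<^sup>2 - 1 \<and> card {i \<in> {..<card U}. a i = j} \<le> k"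
    using balanced_values_index[OF assms(1) _ assms(4), of X] by blast
  show ?thesis
  proof (intro exI[of _ "\<lambda>u. int (a (h u))"] conjI ballI allI)
    show "int (a (h u)) \<in> {0..<int k + 1}" if "u \<in> U" for u
      using a(1)[of "h u"] bij_betwE[OF h(1)] that by auto
    show "(\<Sum>u\<in>U. int (a (h u))) mod (int k + 1) = X mod (int k + 1)"
      using a(2) h(2)[of "\<lambda>i. int (a i)"] by simp
    show "card {u \<in> U. int (a (h u)) = j} \<le> k - 1 \<or> j = 0 \<and> card U = k\<^sup>2 - 1 \<and> card {u \<in> U. int (a (h u)) = j} \<le> k" for j
    proof (cases "j \<ge> 0")
      case True
      then have "{u \<in> U. int (a (h u)) = j} = {u \<in> U. a (h u) = nat j}" by auto
      then show ?thesis using a(3)[of "nat j"] h(3)[of "\<lambda>i. a i = nat j"] True by simp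
    next
      case False
      then have "{u \<in> U. int (a (h u)) = j} = {}" by auto
      then show ?thesis by (simp only: card.empty) simp
    qed
  qed
qed

text \<open>Round robin over the nonzero labels, which keeps 0 free as a mark. The last clause
  provides an element that can later be raised from 1 to 2.\<close>

lemma rows_values:
  assumes "k \<ge> 1" "finite Z" "card Z \<le> k * q"
  obtains a :: "'a \<Rightarrow> int" where "\<And>u. u \<in> Z \<Longrightarrow> a u \<in> {1..int k}" "\<And>j. card {u \<in> Z. a u = j} \<le> q"
    "Z \<noteq> {} \<Longrightarrow> \<exists>u\<in>Z. a u = 1"
proof -
  obtain h where h: "bij_betw h Z {..<card Z}"
    "\<And>Q. card {u \<in> Z. Q (h u)} = card {i \<in> {..<card Z}. Q i}"
    using finite_enumeration[OF assms(2), where 'c = int] by metis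
  show ?thesis
  proof (rule that[of "\<lambda>u. int (h u mod k) + 1"])
    show "int (h u mod k) + 1 \<in> {1..int k}" for u
      using mod_less_divisor[of k "h u"] assms(1) unfolding atLeastAtMost_iff by linarith
    show "card {u \<in> Z. int (h u mod k) + 1 = j} \<le> q" for j
    proof -
      have "card {u \<in> Z. int (h u mod k) + 1 = j} \<le> card {u \<in> Z. h u mod k = nat (j - 1)}"
        using assms(2) by (intro card_mono) auto
      also have "\<dots> = card {i. i < card Z \<and> i mod k = nat (j - 1)}" using h(2)[of "\<lambda>i. i mod k = nat (j - 1)"] by simp
      also have "\<dots> \<le> q" using assms by (intro card_mod_class_le) (auto simp: mult.commute)
      finally show ?thesis .
    qed
    show "\<exists>u\<in>Z. int (h u mod k) + 1 = 1" if "Z \<noteq> {}"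
    proof -
      have "0 \<in> h ` Z" using h(1) that assms(2) by (auto simp: bij_betw_def card_gt_0_iff)
      then show ?thesis by force
    qed
  qed
qed

text \<open>One element \<open>x\<close> is held back to correct the sum. If it would need the
  forbidden value 0, an element of value 1 is raised to 2 and \<open>x\<close> gets
  \<open>k\<close>, which is -1 modulo \<open>k + 1\<close>.\<close>

lemma rows_values_sum:
  fixes X :: int
  assumes k: "k \<ge> 2" and Z: "finite Z" "2 \<le> card Z" "card Z \<le> k\<^sup>2 - 2"
  obtains a :: "'a \<Rightarrow> int" where "\<And>u. u \<in> Z \<Longrightarrow> a u \<in> {1..int k}" "\<And>j. card {u \<in> Z. a u = j} \<le> k + 1"
    "(\<Sum>u\<in>Z. a u) mod (int k + 1) = X mod (int k + 1)"
proof -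
  obtain x where x: "x \<in> Z" using Z(2) by fastforce
  define Y where "Y = Z - {x}"
  have Y: "finite Y" "card Y \<le> k * k" "Z = insert x Y" "x \<notin> Y" "card Z = card Y + 1"
    using Z x by (auto simp: Y_def power2_eq_square)
  then have "Y \<noteq> {}" using Z(2) by auto
  note Y = Y this
  then have cY: "card Y \<le> k\<^sup>2 - 3" using Z by simp
  obtain b :: "'a \<Rightarrow> int" where b: "\<And>u. u \<in> Y \<Longrightarrow> b u \<in> {1..int k}" "\<And>j. card {u \<in> Y. b u = j} \<le> k"
    "\<exists>u\<in>Y. b u = 1"
    using rows_values[of k Y k] Y k by (smt (verit) one_le_numeral order_trans)
  define t where "t = (X - (\<Sum>u\<in>Y. b u)) mod (int k + 1)"
  have row: "card {u \<in> Z. (c(x := s)) u = j} \<le> card {u \<in> Y. c u = j} + of_bool (j = s)" for c :: "'a \<Rightarrow> int" and s j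
  proof -
    have "{u \<in> Z. (c(x := s)) u = j} \<subseteq> {u \<in> Y. c u = j} \<union> (if j = s then {x} else {})" using Y by auto
    then have "card {u \<in> Z. (c(x := s)) u = j} \<le> card ({u \<in> Y. c u = j} \<union> (if j = s then {x} else {}))"
      using Y(1) by (intro card_mono) auto
    also have "\<dots> \<le> card {u \<in> Y. c u = j} + card (if j = s then {x} else {})" by (rule card_Un_le)
    also have "card (if j = s then {x} else {}) = of_bool (j = s)" by simp
    finally show ?thesis .
  qed
  have sm: "(\<Sum>u\<in>Z. (c(x := s)) u) = s + (\<Sum>u\<in>Y. c u)" for c :: "'a \<Rightarrow> int" and s
  proof -
    have "(\<Sum>u\<in>Y. (c(x := s)) u) = (\<Sum>u\<in>Y. c u)" using Y by (intro sum.cong) auto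
    then show ?thesis using Y by simp
  qed
  show ?thesis
  proof (cases "t = 0")
    case False
    have t: "t \<in> {1..int k}" using False by (simp add: t_def)
        (smt (verit) pos_mod_bound pos_mod_sign of_nat_0_le_iff)
    show ?thesis
    proof (rule that[of "b(x := t)"])
      show "(b(x := t)) u \<in> {1..int k}" if "u \<in> Z" for u using t b(1) that Y by auto
      show "card {u \<in> Z. (b(x := t)) u = j} \<le> k + 1" for j
        by (rule order_trans[OF row[of b t j]]) (use b(2)[of j] in \<open>cases "j = t"; simp\<close>)
      show "(\<Sum>u\<in>Z. (b(x := t)) u) mod (int k + 1) = X mod (int k + 1)"
        unfolding sm t_def by (simp add: mod_add_left_eq)
    qed
  next
    case True
    obtain y where y: "y \<in> Y" "b y = 1" using b(3) by blast
    define c where "c = b(y := 2)"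
    have rowc: "card {u \<in> Y. c u = j} \<le> card {u \<in> Y. b u = j} + of_bool (j = 2)" for j
      unfolding c_def by (rule card_fun_upd_class_le) (rule Y(1))
    have "(\<Sum>u\<in>Y. c u) = (\<Sum>u\<in>Y. b u) + 1"
      using Y(1) y unfolding c_def by (simp add: sum.remove)
    then have "(int k + (\<Sum>u\<in>Y. c u)) mod (int k + 1) = ((\<Sum>u\<in>Y. b u) + (int k + 1)) mod (int k + 1)"
      by (simp add: algebra_simps)
    also have "\<dots> = (\<Sum>u\<in>Y. b u) mod (int k + 1)" by (rule mod_add_self2)
    also have "\<dots> = X mod (int k + 1)" using True by (metis t_def mod_eq_dvd_iff mod_0_imp_dvd)
    finally have s: "(int k + (\<Sum>u\<in>Y. c u)) mod (int k + 1) = X mod (int k + 1)" .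
    show ?thesis
    proof (rule that[of "c(x := int k)"])
      show "(c(x := int k)) u \<in> {1..int k}" if "u \<in> Z" for u using b(1) that Y k by (auto simp: c_def)
      show "card {u \<in> Z. (c(x := int k)) u = j} \<le> k + 1" for j
      \<comment> \<open>For \<open>k = 2\<close> both increments fall into the same row, but then
        \<open>Z\<close> has at most \<open>k\<^sup>2 - 2 = 2\<close> elements altogether.\<close>
      proof (cases "k = 2")
        case True
        have "card {u \<in> Z. (c(x := int k)) u = j} \<le> card Z" using Z by (intro card_mono) auto
        then show ?thesis using Z True by simp
      next
        case False
        have "card {u \<in> Z. (c(x := int k)) u = j} \<le> card {u \<in> Y. b u = j} + of_bool (j = 2) + of_bool (j = int k)"
          using row[of c "int k" j] rowc[of j] by linarith
        then show ?thesis using b(2)[of j] False by (cases "j = 2"; cases "j = int k") (simp_all del: fun_upd_apply)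
      qed
      show "(\<Sum>u\<in>Z. (c(x := int k)) u) mod (int k + 1) = X mod (int k + 1)"
        unfolding sm using s by simp
    qed
  qed
qed

text \<open>All but two elements take pairs from the \<open>k\<close> by \<open>k\<close> grid of
  nonzero labels. The last two have a zero coordinate, which keeps them off the grid, and still
  correct both sums: \<open>(0, Y')\<close> and \<open>(X', 0)\<close>, or \<open>(0, 1)\<close> and
  \<open>(0, n - 1)\<close> if nothing is to be corrected.\<close>

lemma distinct_pairs_sums:
  fixes X Y :: int
  assumes k: "k \<ge> 2" and C: "finite C" "2 \<le> card C" "card C \<le> k\<^sup>2 - 1"
  obtains a b :: "'a \<Rightarrow> int" where "\<And>u. u \<in> C \<Longrightarrow> a u \<in> {0..<int k + 1} \<and> b u \<in> {0..<int k + 1}"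
    "inj_on (\<lambda>u. (a u, b u)) C"
    "(\<Sum>u\<in>C. a u) mod (int k + 1) = X mod (int k + 1)" "(\<Sum>u\<in>C. b u) mod (int k + 1) = Y mod (int k + 1)"
proof -
  note outer = that
  define n where "n = int k + 1"
  have n: "n \<ge> 3" using k by (simp add: n_def)
  obtain x y where xy: "x \<in> C" "y \<in> C" "x \<noteq> y"
    using C(2) by (metis One_nat_def Suc_1 card_le_Suc0_iff_eq C(1) not_less_eq_eq)
  define D where "D = C - {x, y}"
  have D: "finite D" "card D \<le> k * k" "C = insert x (insert y D)" "x \<notin> D" "y \<notin> D"
    using C xy by (auto simp: D_def power2_eq_square card_Diff_subset)
  obtain h where h: "bij_betw h D {..<card D}" using finite_enumeration[OF D(1), where 'c = int] by metis
  define p q where "p u = int (h u mod k) + 1" and "q u = int (h u div k) + 1" for u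
  have hk: "h u div k < k" if "u \<in> D" for u
    using bij_betwE[OF h] that D(2) by (auto intro!: less_mult_imp_div_less dest!: bspec)
  have pq: "p u \<in> {1..<n} \<and> q u \<in> {1..<n}" if "u \<in> D" for u
    using hk[OF that] k mod_less_divisor[of k "h u"] unfolding p_def q_def n_def atLeastLessThan_iff by linarith
  have inj: "inj_on (\<lambda>u. (p u, q u)) D"
  proof (rule inj_onI)
    fix u v assume uv: "u \<in> D" "v \<in> D" "(p u, q u) = (p v, q v)"
    then have "h u mod k = h v mod k" "h u div k = h v div k" by (auto simp: p_def q_def)
    then have "h u = h v" by (metis div_mult_mod_eq)
    then show "u = v" using h uv by (auto simp: bij_betw_def inj_on_def)
  qed
  define X' Y' where "X' = (X - (\<Sum>u\<in>D. p u)) mod n" and "Y' = (Y - (\<Sum>u\<in>D. q u)) mod n"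
  have XY: "0 \<le> X'" "X' < n" "0 \<le> Y'" "Y' < n" using n by (auto simp: X'_def Y'_def)
  have fin: thesis if "a0 \<in> {0..<n}" "a1 \<in> {0..<n}" "b0 \<in> {0..<n}" "b1 \<in> {0..<n}" "(a0, b0) \<noteq> (a1, b1)"
    "a0 = 0 \<or> b0 = 0" "a1 = 0 \<or> b1 = 0" "(a0 + a1) mod n = X'" "(b0 + b1) mod n = Y'" for a0 a1 b0 b1
  proof (rule outer[of "p(x := a0, y := a1)" "q(x := b0, y := b1)"])
    show "(p(x := a0, y := a1)) u \<in> {0..<int k + 1} \<and> (q(x := b0, y := b1)) u \<in> {0..<int k + 1}" if "u \<in> C" for u
      using pq[of u] that \<open>a0 \<in> _\<close> \<open>a1 \<in> _\<close> \<open>b0 \<in> _\<close> \<open>b1 \<in> _\<close> D(3) by (auto simp: n_def)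
    show "inj_on (\<lambda>u. ((p(x := a0, y := a1)) u, (q(x := b0, y := b1)) u)) C"
    proof (rule inj_onI)
      fix u v assume uv: "u \<in> C" "v \<in> C" "((p(x := a0, y := a1)) u, (q(x := b0, y := b1)) u) =
        ((p(x := a0, y := a1)) v, (q(x := b0, y := b1)) v)"
      show "u = v"
        using uv D(3-5) xy(3) pq[of u] pq[of v] inj_onD[OF inj, of u v] that(5-7) by (auto split: if_splits)
    qed
    have "(\<Sum>u\<in>C. (p(x := a0, y := a1)) u) = (a0 + a1) + (\<Sum>u\<in>D. p u)"
      using D xy(3) by (simp add: sum.insert) (auto intro!: sum.cong)
    then show "(\<Sum>u\<in>C. (p(x := a0, y := a1)) u) mod (int k + 1) = X mod (int k + 1)"
      using that(8) unfolding X'_def n_def by (metis mod_add_left_eq diff_add_cancel)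
    have "(\<Sum>u\<in>C. (q(x := b0, y := b1)) u) = (b0 + b1) + (\<Sum>u\<in>D. q u)"
      using D xy(3) by (simp add: sum.insert) (auto intro!: sum.cong)
    then show "(\<Sum>u\<in>C. (q(x := b0, y := b1)) u) mod (int k + 1) = Y mod (int k + 1)"
      using that(9) unfolding Y'_def n_def by (metis mod_add_left_eq diff_add_cancel)
  qed
  show thesis
  proof (cases "X' = 0 \<and> Y' = 0")
    case True
    then show thesis using fin[of 0 0 1 "n - 1"] n by auto
  next
    case False
    then show thesis using fin[of 0 X' Y' 0] XY n by auto
  qed
qed

section \<open>Sums of labels at a vertex\<close>

locale finite_graph =
  fixes V :: "'a set" and E :: "'a set set"
  assumes simple: "finite_simple_graph V E"
begin

definition nb :: "'a \<Rightarrow> 'a set" where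
  "nb u = {y. {u, y} \<in> E}"

definition edge_sum :: "('a set \<Rightarrow> int) \<Rightarrow> 'a \<Rightarrow> int" where
  "edge_sum c u = (\<Sum>y\<in>nb u. c {u, y})"

definition label_aut :: "('a set \<Rightarrow> int) \<Rightarrow> ('a \<Rightarrow> 'a) \<Rightarrow> bool" where
  "label_aut c \<phi> \<longleftrightarrow> graph_automorphism V E \<phi> \<and> preserves_labeling E c \<phi>"

lemma edge_in_V: "e \<in> E \<Longrightarrow> e \<subseteq> V"
  using simple by (auto simp: finite_simple_graph_def)

lemma nb_sym: "y \<in> nb u \<longleftrightarrow> u \<in> nb y"
  by (simp add: nb_def insert_commute)

lemma nb_sub: "nb u \<subseteq> V"
  using edge_in_V by (auto simp: nb_def)

lemma finite_V: "finite V"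
  using simple by (simp add: finite_simple_graph_def)

lemma finite_nb [simp]: "finite (nb u)"
  using nb_sub finite_V finite_subset by blast

lemma nb_irrefl [simp]: "u \<notin> nb u"
  using simple by (auto simp: nb_def finite_simple_graph_def)

lemma edge_cases:
  assumes "e \<in> E" "x \<in> e"
  obtains y where "e = {x, y}" "y \<in> nb x"
proof -
  have "card e = 2" using assms simple by (auto simp: finite_simple_graph_def)
  then obtain a b where "e = {a, b}" by (auto simp: card_2_iff)
  then show ?thesis using that assms by (auto simp: nb_def insert_commute)
qed

lemma vertex_degree_eq: "vertex_degree E u = card (nb u)"
proof -
  have "bij_betw (\<lambda>y. {u, y}) (nb u) {e \<in> E. u \<in> e}"
    by (rule bij_betw_imageI) (auto simp: inj_on_def doubleton_eq_iff nb_def elim: edge_cases)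
  then show ?thesis by (simp add: vertex_degree_def bij_betw_same_card)
qed

lemma edge_sum_cong:
  assumes "\<And>y. y \<in> nb u \<Longrightarrow> c {u, y} = c' {u, y}"
  shows "edge_sum c u = edge_sum c' u"
  unfolding edge_sum_def using assms by (rule sum.cong[OF refl])

lemma edge_sum_add: "edge_sum (\<lambda>e. c e + h e) u = edge_sum c u + edge_sum h u"
  by (simp add: edge_sum_def sum.distrib)

lemma label_aut_in_V: "label_aut c \<phi> \<Longrightarrow> u \<in> V \<Longrightarrow> \<phi> u \<in> V"
  by (auto simp: label_aut_def graph_automorphism_def bij_betw_def)

lemma label_aut_inj: "label_aut c \<phi> \<Longrightarrow> u \<in> V \<Longrightarrow> v \<in> V \<Longrightarrow> \<phi> u = \<phi> v \<longleftrightarrow> u = v"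
  by (auto simp: label_aut_def graph_automorphism_def bij_betw_def inj_on_def)

lemma label_aut_edge: "label_aut c \<phi> \<Longrightarrow> u \<in> V \<Longrightarrow> v \<in> V \<Longrightarrow> \<phi> v \<in> nb (\<phi> u) \<longleftrightarrow> v \<in> nb u"
  by (auto simp: label_aut_def graph_automorphism_def nb_def)

lemma label_aut_nb:
  assumes "label_aut c \<phi>" "u \<in> V"
  shows "nb (\<phi> u) = \<phi> ` nb u"
proof
  show "\<phi> ` nb u \<subseteq> nb (\<phi> u)" using assms label_aut_edge nb_sub by blast
  show "nb (\<phi> u) \<subseteq> \<phi> ` nb u"
  proof
    fix y assume y: "y \<in> nb (\<phi> u)"
    then have "y \<in> V" using nb_sub by blast
    moreover have "\<phi> ` V = V"
      using assms(1) by (simp add: label_aut_def graph_automorphism_def bij_betw_def)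
    ultimately obtain x where "x \<in> V" "y = \<phi> x" by blast
    then show "y \<in> \<phi> ` nb u" using y assms label_aut_edge by blast
  qed
qed

lemma label_aut_inj_nb: "label_aut c \<phi> \<Longrightarrow> inj_on \<phi> (nb u)"
  using label_aut_inj nb_sub by (meson inj_onI subsetD)

lemma label_aut_degree: "label_aut c \<phi> \<Longrightarrow> u \<in> V \<Longrightarrow> card (nb (\<phi> u)) = card (nb u)"
  by (simp add: label_aut_nb card_image label_aut_inj_nb)

lemma label_aut_label: "label_aut c \<phi> \<Longrightarrow> y \<in> nb u \<Longrightarrow> c {\<phi> u, \<phi> y} = c {u, y}"
  by (auto simp: label_aut_def preserves_labeling_def nb_def dest!: bspec)

lemma label_aut_edge_sum:
  assumes "label_aut c \<phi>" "u \<in> V"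
  shows "edge_sum c (\<phi> u) = edge_sum c u"
proof -
  have "edge_sum c (\<phi> u) = (\<Sum>y\<in>nb u. c {\<phi> u, \<phi> y})"
    unfolding edge_sum_def label_aut_nb[OF assms] using label_aut_inj_nb[OF assms(1)]
    by (simp add: sum.reindex)
  also have "\<dots> = edge_sum c u" unfolding edge_sum_def
    by (rule sum.cong) (use assms label_aut_label in auto)
  finally show ?thesis .
qed

lemma edge_sum_single:
  assumes "b \<in> nb a"
  shows "edge_sum (\<lambda>e. if e = {a, b} then d else 0) y = (if y = a \<or> y = b then d else 0)"
proof -
  let ?s = "\<lambda>e. if e = {a, b} then d else 0"
  have neq: "a \<noteq> b" and "a \<in> nb b" using assms nb_sym by auto
  have "edge_sum ?s a = (\<Sum>z\<in>nb a. if z = b then d else 0)" unfolding edge_sum_def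
    by (rule sum.cong) (auto simp: doubleton_eq_iff neq)
  moreover have "edge_sum ?s b = (\<Sum>z\<in>nb b. if z = a then d else 0)" unfolding edge_sum_def
    by (rule sum.cong) (auto simp: doubleton_eq_iff neq)
  moreover have "edge_sum ?s y = 0" if "y \<noteq> a" "y \<noteq> b" unfolding edge_sum_def
    by (rule sum.neutral) (use that in \<open>auto simp: doubleton_eq_iff\<close>)
  ultimately show ?thesis using assms \<open>a \<in> nb b\<close> by auto
qed

text \<open>Alternating \<open>d\<close> and \<open>-d\<close> along a walk changes the sums at its two ends only.\<close>

lemma shift_along_walk:
  assumes "(u, x) \<in> {(a, b). {a, b} \<in> M}\<^sup>*" "x \<in> R" "M \<subseteq> E"
  shows "\<exists>h. (\<forall>e. e \<notin> M \<longrightarrow> h e = 0) \<and> (\<forall>y. y \<notin> R \<longrightarrow> edge_sum h y = (if y = u then d else 0))"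
  using assms(1)
proof (induction arbitrary: d rule: converse_rtrancl_induct)
  case base
  show ?case using assms(2) by (intro exI[of _ "\<lambda>_. 0"]) (auto simp: edge_sum_def)
next
  case (step u v)
  obtain h where h: "\<forall>e. e \<notin> M \<longrightarrow> h e = 0" "\<forall>y. y \<notin> R \<longrightarrow> edge_sum h y = (if y = v then - d else 0)"
    using step.IH by blast
  have uv: "{u, v} \<in> M" "v \<in> nb u" using step.hyps(1) assms(3) by (auto simp: nb_def)
  then have neq: "u \<noteq> v" by auto
  define s where "s e = (if e = {u, v} then d else 0)" for e
  have s: "edge_sum s y = (if y = u \<or> y = v then d else 0)" for y
    unfolding s_def using uv(2) by (rule edge_sum_single)
  show ?case
  proof (intro exI[of _ "\<lambda>e. s e + h e"] conjI allI impI)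
    show "s e + h e = 0" if "e \<notin> M" for e using that uv h by (auto simp: s_def)
    show "edge_sum (\<lambda>e. s e + h e) y = (if y = u then d else 0)" if "y \<notin> R" for y
    proof -
      have "edge_sum h y = (if y = v then - d else 0)" using h(2) that by blast
      then show ?thesis unfolding edge_sum_add s using neq by simp
    qed
  qed
qed

text \<open>\<open>R\<close> holds the vertices whose sums do not matter. Each \<open>u\<close> in
  \<open>T\<close> sends its correction along a walk in \<open>M\<close> into \<open>R\<close>, and
  these modifications add up without disturbing any other sum outside \<open>R\<close>.\<close>

lemma prescribe_edge_sums:
  assumes "finite T" "\<And>u. u \<in> T \<Longrightarrow> \<exists>x\<in>R. (u, x) \<in> {(a, b). {a, b} \<in> M}\<^sup>*" "M \<subseteq> E"
  shows "\<exists>h. (\<forall>e. e \<notin> M \<longrightarrow> h e = 0) \<and> (\<forall>y. y \<notin> R \<longrightarrow> edge_sum h y = (if y \<in> T then g y else 0))"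
  using assms(1,2)
proof (induction T rule: finite_induct)
  case empty
  show ?case by (intro exI[of _ "\<lambda>_. 0"]) (auto simp: edge_sum_def)
next
  case (insert u T)
  obtain h where h: "\<forall>e. e \<notin> M \<longrightarrow> h e = 0" "\<forall>y. y \<notin> R \<longrightarrow> edge_sum h y = (if y \<in> T then g y else 0)"
    using insert by blast
  obtain x where x: "x \<in> R" "(u, x) \<in> {(a, b). {a, b} \<in> M}\<^sup>*" using insert.prems by blast
  from shift_along_walk[OF x(2,1) assms(3), of "g u"] obtain s where "(\<forall>e. e \<notin> M \<longrightarrow> s e = 0) \<and> (\<forall>y. y \<notin> R \<longrightarrow> edge_sum s y = (if y = u then g u else 0))"
    by (rule exE)
  then have s: "\<And>e. e \<notin> M \<Longrightarrow> s e = 0" "\<And>y. y \<notin> R \<Longrightarrow> edge_sum s y = (if y = u then g u else 0)"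
    by (rule conjE, simp)+
  show ?case
  proof (intro exI[of _ "\<lambda>e. s e + h e"] conjI allI impI)
    show "s e + h e = 0" if "e \<notin> M" for e using that h(1) s(1) by simp
    show "edge_sum (\<lambda>e. s e + h e) y = (if y \<in> insert u T then g y else 0)" if "y \<notin> R" for y
    proof -
      have "edge_sum h y = (if y \<in> T then g y else 0)" using h(2) that by blast
      then show ?thesis unfolding edge_sum_add s(2)[OF that] using insert.hyps by auto
    qed
  qed
qed

end

section \<open>Graphs with a root of maximum degree\<close>

locale rooted_graph = finite_graph +
  fixes r :: 'a and k :: nat
  assumes connected: "connected_graph V E"
    and min_deg: "\<And>u. u \<in> V \<Longrightarrow> card (nb u) \<ge> 2"
    and r_V: "r \<in> V"
    and max_deg: "\<And>u. u \<in> V \<Longrightarrow> card (nb u) \<le> card (nb r)"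
    and k2: "k \<ge> 2"
    and max_deg_le: "card (nb r) \<le> k\<^sup>2"
begin

lemma closed_eq_V:
  assumes "S \<subseteq> V" "u \<in> S" "\<And>x. x \<in> S \<Longrightarrow> nb x \<subseteq> S"
  shows "S = V"
proof -
  have "v \<in> S" if "v \<in> V" for v
  proof -
    have "(u, v) \<in> {(x, y). {x, y} \<in> E}\<^sup>*" using connected assms(1,2) that by (auto simp: connected_graph_def)
    then show ?thesis
      by (induction rule: rtrancl_induct) (use assms nb_def in auto)
  qed
  then show ?thesis using assms(1) by blast
qed

definition distinguishable :: bool where
  "distinguishable \<longleftrightarrow> (\<exists>c. (\<forall>e. c e \<in> {0..<int k + 1}) \<and> (\<forall>\<phi>. label_aut c \<phi> \<longrightarrow> (\<forall>v\<in>V. \<phi> v = v)))"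

text \<open>If every further vertex is adjacent to both \<open>r\<close> and \<open>w\<close>, then \<open>r\<close> can be made the only
  vertex of maximum degree without an edge labeled \<open>0\<close>.\<close>

lemma distinguishable_twins:
  assumes w: "w \<in> V" "w \<noteq> r" and H: "\<And>u. u \<in> V - {r, w} \<Longrightarrow> u \<in> nb r \<and> u \<in> nb w"
  shows distinguishable
proof -
  define H where "H = V - {r, w}"
  have finH: "finite H" using finite_V by (simp add: H_def)
  have Hnb: "u \<in> nb r" "u \<in> nb w" if "u \<in> H" for u using H that by (auto simp: H_def)
  have nbr: "nb r = H \<union> (if w \<in> nb r then {w} else {})" using Hnb nb_sub[of r] by (auto simp: H_def)
  have nbw: "nb w = H \<union> (if w \<in> nb r then {r} else {})" using Hnb nb_sub[of w] nb_sym[of w r] by (auto simp: H_def)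
  \<comment> \<open>If \<open>r\<close> and \<open>w\<close> are adjacent, label \<open>k\<close> is
    reserved for their edge, and \<open>F\<close> has only \<open>k - 1\<close> values. This
    suffices, as \<open>H\<close> then has at most \<open>k\<^sup>2 - 1 = (k - 1) * (k + 1)\<close>
    elements.\<close>
  define q where "q = (if w \<in> nb r then k - 1 else k)"
  have q: "1 \<le> q" "q \<le> k" using k2 by (auto simp: q_def)
  have cardr: "card (nb r) = card H + (if w \<in> nb r then 1 else 0)"
    by (subst nbr) (use finH in \<open>auto simp: H_def\<close>)
  have "card H \<le> q * (k + 1)"
  proof (cases "w \<in> nb r")
    case True
    then have "card H \<le> k\<^sup>2 - 1" using cardr max_deg_le by simp
    also have "\<dots> = q * (k + 1)" using True by (simp add: q_def power2_eq_square algebra_simps)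
    finally show ?thesis .
  next
    case False
    then have "card H \<le> k * k" using cardr max_deg_le by (simp add: power2_eq_square)
    then show ?thesis using False by (simp add: q_def)
  qed
  moreover obtain h where h: "bij_betw h H {..<card H}" using finite_enumeration[OF finH, where 'c = int] by metis
  ultimately have hlt: "h u div q \<le> k" if "u \<in> H" for u
    using bij_betwE[OF h] that less_mult_imp_div_less[of "h u" "k + 1" q] by (fastforce simp: mult.commute)
  \<comment> \<open>Remainder and quotient of the index identify each element of \<open>H\<close> by
    its labels to \<open>r\<close> and \<open>w\<close>. The shift by 1 keeps 0 away from
    \<open>r\<close>, whereas \<open>G\<close> and the edges inside \<open>H\<close> use it.\<close>
  define F where "F u = int (h u mod q) + 1" for u
  define G where "G u = int (h u div q)" for u
  have F: "1 \<le> F u" "F u \<le> int q" for u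
    using q mod_less_divisor[of q "h u"] unfolding F_def by linarith+
  have G: "0 \<le> G u" "u \<in> H \<Longrightarrow> G u \<le> int k" for u using hlt by (auto simp: G_def)
  define c where "c e = (if e = {r, w} then int k else if \<exists>u\<in>H. e = {r, u} then F (the_elem (e - {r}))
    else if \<exists>u\<in>H. e = {w, u} then G (the_elem (e - {w})) else 0)" for e
  have rwH: "r \<notin> H" "w \<notin> H" by (auto simp: H_def)
  have crw: "c {r, w} = int k" by (simp add: c_def)
  have cru: "c {r, u} = F u" if "u \<in> H" for u
  proof -
    have "{r, u} - {r} = {u}" using that rwH by auto
    then show ?thesis using that rwH w by (auto simp: c_def doubleton_eq_iff)
  qed
  have cwu: "c {w, u} = G u" if "u \<in> H" for u
  proof -
    have "{w, u} - {w} = {u}" using that rwH by auto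
    then show ?thesis using that rwH w by (auto simp: c_def doubleton_eq_iff)
  qed
  have cuu: "c {u, v} = 0" if "u \<in> H" "v \<in> H" for u v
    using that rwH by (auto simp: c_def doubleton_eq_iff)
  have range: "c e \<in> {0..<int k + 1}" for e
  proof -
    consider "e = {r, w}" | u where "u \<in> H" "e = {r, u}" | u where "u \<in> H" "e = {w, u}" | "c e = 0"
      unfolding c_def by metis
    then show ?thesis
    proof cases
      case 2
      then show ?thesis using cru[of u] F[of u] q by auto
    next
      case 3
      then show ?thesis using cwu[of u] G[of u] by auto
    qed (use crw in auto)
  qed
  have Hne: "H \<noteq> {}" using cardr min_deg[OF r_V] by (auto split: if_splits)
  then obtain u0 where u0: "u0 \<in> H" "h u0 = 0" using h finH
    by (metis bij_betw_def card_gt_0_iff imageE lessThan_iff)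
  have r_no0: "c {r, y} \<noteq> 0" if "y \<in> nb r" for y
    using that nbr cru[of y] F[of y] crw k2 by (auto split: if_splits)
  have has0: "\<exists>y\<in>nb x. c {x, y} = 0" if x: "x \<in> V" "x \<noteq> r" "card (nb x) = card (nb r)" for x
  proof (cases "x = w")
    case True
    then show ?thesis using u0 Hnb(2)[of u0] nb_sym cwu[of u0] by (auto simp: G_def)
  next
    case False
    then have xH: "x \<in> H" using x by (simp add: H_def)
    show ?thesis
    proof (cases "nb x \<inter> H = {}")
      case False
      then show ?thesis using cuu xH by blast
    next
      case True
      \<comment> \<open>Here \<open>x\<close> has degree 2. As this is the maximum degree,
        \<open>H\<close> has at most \<open>q\<close> elements, and \<open>G\<close> is 0 on all of
        them.\<close>
      then have nbx: "nb x = {r, w}" using Hnb[OF xH] nb_sub[of x] nb_sym by (auto simp: H_def)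
      then have "card (nb r) = 2" using x w by simp
      then have "card H \<le> q" using cardr k2 by (auto simp: q_def split: if_splits)
      then have "G x = 0" using bij_betwE[OF h] xH by (fastforce simp: G_def)
      then show ?thesis using nbx cwu[OF xH] by (intro bexI[of _ w]) (auto simp: insert_commute)
    qed
  qed
  have "\<phi> v = v" if \<phi>: "label_aut c \<phi>" and v: "v \<in> V" for \<phi> v
  proof -
    have \<phi>r: "\<phi> r = r"
    proof (rule ccontr)
      assume "\<phi> r \<noteq> r"
      then obtain y where y: "y \<in> nb (\<phi> r)" "c {\<phi> r, y} = 0"
        using has0[of "\<phi> r"] label_aut_in_V[OF \<phi> r_V] label_aut_degree[OF \<phi> r_V] by auto
      then obtain x where "x \<in> nb r" "y = \<phi> x" using label_aut_nb[OF \<phi> r_V] by auto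
      then show False using y label_aut_label[OF \<phi>] r_no0 by metis
    qed
    \<comment> \<open>Either \<open>w\<close> is the end of the only edge at \<open>r\<close>
      labeled \<open>k\<close>, or it is the only vertex besides \<open>r\<close> that is not
      adjacent to \<open>r\<close>.\<close>
    have \<phi>w: "\<phi> w = w"
    proof (cases "w \<in> nb r")
      case True
      then have a: "\<phi> w \<in> nb r" "c {r, \<phi> w} = int k"
        using label_aut_edge[OF \<phi> r_V w(1)] label_aut_label[OF \<phi>, of w r] \<phi>r crw by auto
      then have "\<phi> w \<notin> H" using cru[of "\<phi> w"] F(2)[of "\<phi> w"] True k2 by (auto simp: q_def)
      then show ?thesis using a(1) nbr True by simp
    next
      case False
      then have "\<phi> w \<notin> nb r" using label_aut_edge[OF \<phi> r_V w(1)] \<phi>r by simp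
      moreover have "\<phi> w \<noteq> r" using label_aut_inj[OF \<phi> w(1) r_V] \<phi>r w by auto
      ultimately show ?thesis using label_aut_in_V[OF \<phi> w(1)] nbr by (auto simp: H_def)
    qed
    show ?thesis
    proof (cases "v \<in> H")
      case True
      then have "\<phi> v \<in> H" using label_aut_in_V[OF \<phi> v] label_aut_inj[OF \<phi>] v r_V w \<phi>r \<phi>w
        by (metis DiffI H_def insertE empty_iff rwH)
      moreover have "F (\<phi> v) = F v" "G (\<phi> v) = G v"
        using label_aut_label[OF \<phi>, of v r] label_aut_label[OF \<phi>, of v w] Hnb[OF True] \<phi>r \<phi>w cru cwu True
          \<open>\<phi> v \<in> H\<close> by auto
      then have "h (\<phi> v) = h v" unfolding F_def G_def by (metis add_right_cancel div_mult_mod_eq of_nat_eq_iff)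
      ultimately show ?thesis using h True by (auto simp: bij_betw_def inj_on_def)
    next
      case False
      then show ?thesis using v \<phi>r \<phi>w by (auto simp: H_def)
    qed
  qed
  then show ?thesis using range unfolding distinguishable_def by blast
qed

definition sig :: "('a set \<Rightarrow> int) \<Rightarrow> 'a \<Rightarrow> int" where
  "sig c u = edge_sum c u mod (int k + 1)"

section \<open>Partial labelings\<close>

text \<open>The root is recognized by its degree, its sum \<open>\<rho>\<close>, and having no edge labeled \<open>0\<close> to a
  vertex of maximum degree. The vertices satisfying \<open>avoids\<close> may therefore not have sum \<open>\<rho>\<close>.\<close>

definition avoids :: "('a set \<Rightarrow> int) \<Rightarrow> 'a set \<Rightarrow> 'a \<Rightarrow> bool" where
  "avoids c S u \<longleftrightarrow> card (nb u) = card (nb r) \<and>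
     \<not> (\<exists>y\<in>nb u \<inter> S. card (nb y) = card (nb r) \<and> c {u, y} = 0)"

text \<open>Quantifying over all labelings \<open>c'\<close> that agree with \<open>c\<close> on
  \<open>S\<close> lets the property survive later steps. The separation inside the classes
  \<open>K u\<close> is only assumed, since it rests on sums that are not yet final.\<close>

definition rigid :: "'a set \<Rightarrow> ('a set \<Rightarrow> int) \<Rightarrow> ('a \<Rightarrow> 'a set) \<Rightarrow> bool" where
  "rigid S c K \<longleftrightarrow> (\<forall>c' \<phi>. (\<forall>e. e \<subseteq> S \<longrightarrow> c' e = c e) \<longrightarrow> label_aut c' \<phi> \<longrightarrow> \<phi> r = r \<longrightarrow>
     (\<forall>u\<in>S. \<forall>u'\<in>K u. u' \<noteq> u \<longrightarrow> sig c' u \<noteq> sig c' u') \<longrightarrow> (\<forall>u\<in>S. \<phi> u = u))"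

lemma mod_range: "z mod (int k + 1) \<in> {0..<int k + 1}"
  using pos_mod_bound[of "int k + 1" z] pos_mod_sign[of "int k + 1" z] by simp

lemma sig_mod: "sig (\<lambda>e. f e mod (int k + 1)) x = edge_sum f x mod (int k + 1)"
  unfolding sig_def edge_sum_def by (rule mod_sum_eq)

lemma label_aut_sig: "label_aut c \<phi> \<Longrightarrow> u \<in> V \<Longrightarrow> sig c (\<phi> u) = sig c u"
  by (simp add: sig_def label_aut_edge_sum)

end

text \<open>\<open>K u\<close> is the set of vertices from which \<open>u\<close> still has to be separated by its final sum. The sum
  of a vertex is only fixed once its last neighbour joins \<open>S\<close>; \<open>slack\<close> guarantees that an admissible
  value is left then, and two of them if the vertex is not a neighbour of the root.\<close>

locale partial_labeling = rooted_graph +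
  fixes \<rho> :: int and S :: "'a set" and c :: "'a set \<Rightarrow> int" and K :: "'a \<Rightarrow> 'a set"
  assumes S_sub: "S \<subseteq> V"
    and r_S: "r \<in> S"
    and c_range: "\<And>e. c e \<in> {0..<int k + 1}"
    and c_out: "\<And>e. \<not> e \<subseteq> S \<Longrightarrow> c e = 0"
    and parent: "\<And>u. u \<in> S \<Longrightarrow> u \<noteq> r \<Longrightarrow> nb u \<inter> S \<noteq> {}"
    and K_self: "\<And>u. u \<in> S \<Longrightarrow> u \<in> K u"
    and K_sub: "\<And>u. u \<in> S \<Longrightarrow> K u \<subseteq> S"
    and K_eq: "\<And>u u'. u \<in> S \<Longrightarrow> u' \<in> K u \<Longrightarrow> K u' = K u"
    and finished_distinct: "\<And>u u'. u \<in> S \<Longrightarrow> u' \<in> K u \<Longrightarrow> u' \<noteq> u \<Longrightarrow> nb u \<subseteq> S \<Longrightarrow> nb u' \<subseteq> S \<Longrightarrow> sig c u \<noteq> sig c u'"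
    and finished_avoids: "\<And>u. u \<in> S \<Longrightarrow> u \<noteq> r \<Longrightarrow> nb u \<subseteq> S \<Longrightarrow> avoids c S u \<Longrightarrow> sig c u \<noteq> \<rho>"
    and slack: "\<And>u. u \<in> S \<Longrightarrow> u \<noteq> r \<Longrightarrow> \<not> nb u \<subseteq> S \<Longrightarrow>
      card (K u) + of_bool (avoids c S u) \<le> (if u \<in> nb r then k + 1 else k)"
    and rigid: "rigid S c K"
begin

lemma finite_S: "finite S"
  using S_sub finite_V finite_subset by blast

lemma finite_K: "u \<in> S \<Longrightarrow> finite (K u)"
  using K_sub finite_S finite_subset by blast

text \<open>As \<open>c\<close> vanishes off \<open>S\<close>, \<open>edge_sum c t\<close> is the
  part of the sum that is already decided.\<close>

lemma edge_sum_extend: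
  assumes "\<And>e. e \<subseteq> S \<Longrightarrow> c' e = c e" "t \<in> S"
  shows "edge_sum c' t = edge_sum c t + (\<Sum>u\<in>nb t - S. c' {t, u})"
proof -
  have "edge_sum c' t = (\<Sum>u\<in>nb t \<inter> S. c' {t, u}) + (\<Sum>u\<in>nb t - S. c' {t, u})"
    unfolding edge_sum_def by (metis add.commute finite_nb sum.Int_Diff)
  moreover have "(\<Sum>u\<in>nb t \<inter> S. c' {t, u}) = (\<Sum>u\<in>nb t \<inter> S. c {t, u})"
    by (rule sum.cong) (use assms in auto)
  moreover have "edge_sum c t = (\<Sum>u\<in>nb t \<inter> S. c {t, u}) + (\<Sum>u\<in>nb t - S. c {t, u})"
    unfolding edge_sum_def by (metis add.commute finite_nb sum.Int_Diff)
  moreover have "(\<Sum>u\<in>nb t - S. c {t, u}) = 0"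
    by (rule sum.neutral) (use c_out in auto)
  ultimately show ?thesis by simp
qed

lemma sig_finished:
  assumes "\<And>e. e \<subseteq> S \<Longrightarrow> c' e = c e" "u \<in> S" "nb u \<subseteq> S"
  shows "sig c' u = sig c u"
  unfolding sig_def using assms by (metis edge_sum_cong empty_subsetI insert_subset subsetD)

text \<open>Reduces the invariant to what a new layer \<open>C\<close> really affects. Classes never
  mix old and new vertices, and for an old vertex \<open>avoids\<close> can only turn from true to
  false; so only the vertices completed by \<open>C\<close> and those of \<open>C\<close> itself
  need attention.\<close>

lemma extend:
  assumes C: "C \<subseteq> V" "C \<inter> S = {}" "\<And>u. u \<in> C \<Longrightarrow> nb u \<inter> S \<noteq> {}"
    and c': "\<And>e. c' e \<in> {0..<int k + 1}" "\<And>e. e \<subseteq> S \<Longrightarrow> c' e = c e" "\<And>e. \<not> e \<subseteq> S \<union> C \<Longrightarrow> c' e = 0"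
    and K': "\<And>u. u \<in> C \<Longrightarrow> u \<in> K' u" "\<And>u. u \<in> C \<Longrightarrow> K' u \<subseteq> C" "\<And>u u'. u \<in> C \<Longrightarrow> u' \<in> K' u \<Longrightarrow> K' u' = K' u"
    and old: "\<And>t t'. t \<in> S \<Longrightarrow> \<not> nb t \<subseteq> S \<Longrightarrow> nb t \<subseteq> S \<union> C \<Longrightarrow> t' \<in> K t \<Longrightarrow> t' \<noteq> t \<Longrightarrow> nb t' \<subseteq> S \<union> C \<Longrightarrow> sig c' t \<noteq> sig c' t'"
      "\<And>t. t \<in> S \<Longrightarrow> t \<noteq> r \<Longrightarrow> \<not> nb t \<subseteq> S \<Longrightarrow> nb t \<subseteq> S \<union> C \<Longrightarrow> avoids c S t \<Longrightarrow> sig c' t \<noteq> \<rho>"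
    and new: "\<And>u u'. u \<in> C \<Longrightarrow> nb u \<subseteq> S \<union> C \<Longrightarrow> u' \<in> K' u \<Longrightarrow> u' \<noteq> u \<Longrightarrow> nb u' \<subseteq> S \<union> C \<Longrightarrow> sig c' u \<noteq> sig c' u'"
      "\<And>u. u \<in> C \<Longrightarrow> nb u \<subseteq> S \<union> C \<Longrightarrow> avoids c' (S \<union> C) u \<Longrightarrow> sig c' u \<noteq> \<rho>"
      "\<And>u. u \<in> C \<Longrightarrow> \<not> nb u \<subseteq> S \<union> C \<Longrightarrow> card (K' u) + of_bool (avoids c' (S \<union> C) u) \<le> (if u \<in> nb r then k + 1 else k)"
    and rig: "\<And>c'' \<phi>. (\<And>e. e \<subseteq> S \<union> C \<Longrightarrow> c'' e = c' e) \<Longrightarrow> label_aut c'' \<phi> \<Longrightarrow> (\<And>u. u \<in> S \<Longrightarrow> \<phi> u = u) \<Longrightarrow>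
      (\<And>u u'. u \<in> C \<Longrightarrow> u' \<in> K' u \<Longrightarrow> u' \<noteq> u \<Longrightarrow> sig c'' u \<noteq> sig c'' u') \<Longrightarrow> \<forall>u\<in>C. \<phi> u = u"
  shows "partial_labeling V E r k \<rho> (S \<union> C) c' (\<lambda>u. if u \<in> C then K' u else K u)"
proof -
  have CS: "u \<in> S \<Longrightarrow> u \<notin> C" for u using C by blast
  have KC: "u \<in> S \<Longrightarrow> u' \<in> K u \<Longrightarrow> u' \<in> S" for u u' using K_sub by blast
  have sig_old: "sig c' u = sig c u" if "nb u \<subseteq> S" "u \<in> S" for u
    using sig_finished[OF c'(2)] that by blast
  have av: "avoids c S u" if "avoids c' (S \<union> C) u" "u \<in> S" for u
    using that c'(2) unfolding avoids_def by auto
  show ?thesis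
  proof (intro partial_labeling.intro partial_labeling_axioms.intro)
    show "rooted_graph V E r k" by unfold_locales
    show "S \<union> C \<subseteq> V" "r \<in> S \<union> C" using S_sub C r_S by auto
    show "c' e \<in> {0..<int k + 1}" for e by (rule c')
    show "c' e = 0" if "\<not> e \<subseteq> S \<union> C" for e using that by (rule c')
    show "nb u \<inter> (S \<union> C) \<noteq> {}" if "u \<in> S \<union> C" "u \<noteq> r" for u using that parent C(3) by blast
    show "u \<in> (if u \<in> C then K' u else K u)" if "u \<in> S \<union> C" for u
    proof (cases "u \<in> C")
      case True
      then show ?thesis using K'(1) by simp
    next
      case False
      then show ?thesis using K_self that by simp
    qed
    show "(if u \<in> C then K' u else K u) \<subseteq> S \<union> C" if "u \<in> S \<union> C" for u
    proof (cases "u \<in> C")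
      case True
      then show ?thesis using K'(2)[OF True] by (simp add: le_supI2)
    next
      case False
      then show ?thesis using K_sub[of u] that by (simp add: le_supI1)
    qed
    show "(if u' \<in> C then K' u' else K u') = (if u \<in> C then K' u else K u)"
      if "u \<in> S \<union> C" "u' \<in> (if u \<in> C then K' u else K u)" for u u'
    proof (cases "u \<in> C")
      case True
      then have "u' \<in> K' u" using that by simp
      then show ?thesis using K'(2)[OF True] K'(3)[OF True] True by auto
    next
      case False
      then have "u \<in> S" "u' \<in> K u" using that by simp_all
      then have "u' \<notin> C" "K u' = K u" using KC CS K_eq by blast+
      then show ?thesis using False by simp
    qed
    show "sig c' u \<noteq> sig c' u'" if "u \<in> S \<union> C" "u' \<in> (if u \<in> C then K' u else K u)" "u' \<noteq> u"
      "nb u \<subseteq> S \<union> C" "nb u' \<subseteq> S \<union> C" for u u'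
    proof (cases "u \<in> C")
      case True
      then show ?thesis using that new(1) by auto
    next
      case False
      then have u: "u \<in> S" "u' \<in> K u" using that by simp_all
      then have u: "u \<in> S" "u' \<in> K u" "u' \<in> S" "K u' = K u" by (simp, simp, blast intro: KC, blast dest: K_eq)
      show ?thesis
      proof (cases "nb u \<subseteq> S")
        case t: True
        show ?thesis
        proof (cases "nb u' \<subseteq> S")
          case True
          then show ?thesis using t u that finished_distinct sig_old by metis
        next
          case False
          \<comment> \<open>It is \<open>u'\<close> that is completed in this step; since classes
            are symmetric, the obligation is used with the two vertices exchanged.\<close>
          have "sig c' u' \<noteq> sig c' u" by (rule old(1)) (use False u that K_self in auto)
          then show ?thesis by simp
        qed
      next
        case False
        show ?thesis by (rule old(1)) (use False u that in auto)
      qed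
    qed
    show "sig c' u \<noteq> \<rho>" if "u \<in> S \<union> C" "u \<noteq> r" "nb u \<subseteq> S \<union> C" "avoids c' (S \<union> C) u" for u
      using that new(2) old(2) av finished_avoids sig_old by (metis UnE)
    show "card (if u \<in> C then K' u else K u) + of_bool (avoids c' (S \<union> C) u) \<le> (if u \<in> nb r then k + 1 else k)"
      if "u \<in> S \<union> C" "u \<noteq> r" "\<not> nb u \<subseteq> S \<union> C" for u
    proof (cases "u \<in> C")
      case True
      then show ?thesis using that new(3) by auto
    next
      case False
      then have "card (K u) + of_bool (avoids c S u) \<le> (if u \<in> nb r then k + 1 else k)"
        by (intro slack) (use that in auto)
      moreover have "of_bool (avoids c' (S \<union> C) u) \<le> (of_bool (avoids c S u) :: nat)" using av that False by auto
      ultimately have "card (K u) + of_bool (avoids c' (S \<union> C) u) \<le> (if u \<in> nb r then k + 1 else k)" by linarith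
      then show ?thesis using False by (simp only: if_False)
    qed
    show "rigid (S \<union> C) c' (\<lambda>u. if u \<in> C then K' u else K u)"
      unfolding rigid_def
    proof (intro allI impI)
      fix c'' \<phi>
      assume a: "\<forall>e. e \<subseteq> S \<union> C \<longrightarrow> c'' e = c' e" "label_aut c'' \<phi>" "\<phi> r = r"
        "\<forall>u\<in>S \<union> C. \<forall>u'\<in>(if u \<in> C then K' u else K u). u' \<noteq> u \<longrightarrow> sig c'' u \<noteq> sig c'' u'"
      have "\<forall>e. e \<subseteq> S \<longrightarrow> c'' e = c e" using a(1) c'(2) by auto
      moreover have "\<forall>u\<in>S. \<forall>u'\<in>K u. u' \<noteq> u \<longrightarrow> sig c'' u \<noteq> sig c'' u'" using a(4) CS by fastforce
      ultimately have S: "\<forall>u\<in>S. \<phi> u = u" using rigid a(2,3) unfolding rigid_def by blast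
      have "\<forall>u\<in>C. \<phi> u = u"
        by (rule rig[of c'' \<phi>]) (use a S in auto)
      then show "\<forall>u\<in>S \<union> C. \<phi> u = u" using S by blast
    qed
  qed
qed

text \<open>Target sums for the vertices \<open>P\<close> that are completed in the current step.
  Classmates that remain incomplete impose nothing yet.\<close>

definition valid_sums :: "'a set \<Rightarrow> ('a \<Rightarrow> int) \<Rightarrow> bool" where
  "valid_sums P g \<longleftrightarrow> (\<forall>t\<in>P. g t \<in> {0..<int k + 1} \<and> (avoids c S t \<longrightarrow> g t \<noteq> \<rho>) \<and>
     (\<forall>t'\<in>K t. t' \<noteq> t \<longrightarrow> t' \<in> P \<longrightarrow> g t' \<noteq> g t) \<and> (\<forall>t'\<in>K t. nb t' \<subseteq> S \<longrightarrow> g t \<noteq> sig c t'))"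

text \<open>By \<open>slack\<close>, excluding the sums of all classmates and, where required,
  \<open>\<rho>\<close> leaves at least one of the \<open>k + 1\<close> residues, so a greedy choice
  succeeds.\<close>

lemma ex_valid_sums:
  assumes "P \<subseteq> S - {r}" "\<And>t. t \<in> P \<Longrightarrow> \<not> nb t \<subseteq> S"
  shows "\<exists>g. valid_sums P g"
proof -
  define F where "F t = sig c ` {t' \<in> K t. nb t' \<subseteq> S} \<union> (if avoids c S t then {\<rho>} else {})" for t
  have "\<exists>g. \<forall>u\<in>P. g u \<in> {0..<int (k + 1)} \<and> g u \<notin> F u \<and> (\<forall>u'\<in>K u \<inter> P. u' \<noteq> u \<longrightarrow> g u \<noteq> g u')"
  proof (rule greedy_choice)
    show "finite P" using assms(1) finite_S finite_subset by blast
    show "u \<in> K u'" if "u \<in> P" "u' \<in> P" "u' \<in> K u" for u u'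
      using that assms(1) K_eq[of u u'] K_self[of u] by auto
    show "finite (F u) \<and> card (F u) + card (K u \<inter> P - {u}) < k + 1" if u: "u \<in> P" for u
    proof -
      have uS: "u \<in> S" "u \<noteq> r" "\<not> nb u \<subseteq> S" using assms u by auto
      have fin: "finite (K u)" using finite_K uS by blast
      let ?A = "{t' \<in> K u. nb t' \<subseteq> S}" and ?B = "K u \<inter> P - {u}"
      have "card (F u) \<le> card (sig c ` ?A) + card (if avoids c S u then {\<rho>} else {})" unfolding F_def by (rule card_Un_le)
      also have "\<dots> \<le> card ?A + of_bool (avoids c S u)" using fin card_image_le[of ?A "sig c"] by auto
      finally have 1: "card (F u) \<le> card ?A + of_bool (avoids c S u)" .
      have "card ?A + card ?B = card (?A \<union> ?B)" using fin assms(2) by (subst card_Un_disjoint) auto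
      also have "\<dots> \<le> card (K u - {u})" using fin uS by (intro card_mono) auto
      also have "\<dots> = card (K u) - 1" using K_self[OF uS(1)] by simp
      finally have 2: "card ?A + card ?B \<le> card (K u) - 1" .
      have "card (K u) \<ge> 1" using fin K_self[OF uS(1)] by (metis One_nat_def Suc_leI card_gt_0_iff empty_iff)
      moreover have "card (K u) + of_bool (avoids c S u) \<le> k + 1" using slack[OF uS] by (auto split: if_splits)
      ultimately have "card (F u) + card ?B < k + 1" using 1 2 by linarith
      moreover have "finite (F u)" using fin by (simp add: F_def)
      ultimately show ?thesis by blast
    qed
  qed
  then obtain g where g: "\<forall>u\<in>P. g u \<in> {0..<int (k + 1)} \<and> g u \<notin> F u \<and> (\<forall>u'\<in>K u \<inter> P. u' \<noteq> u \<longrightarrow> g u \<noteq> g u')"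
    by blast
  have "valid_sums P g" unfolding valid_sums_def
  proof (intro ballI conjI impI)
    show "g t \<in> {0..<int k + 1}" if "t \<in> P" for t using g that by auto
    show "g t \<noteq> \<rho>" if "t \<in> P" "avoids c S t" for t using g that by (auto simp: F_def)
    show "g t' \<noteq> g t" if "t \<in> P" "t' \<in> K t" "t' \<noteq> t" "t' \<in> P" for t t' using g that by fastforce
    show "g t \<noteq> sig c t'" if "t \<in> P" "t' \<in> K t" "nb t' \<subseteq> S" for t t' using g that by (auto simp: F_def)
  qed
  then show ?thesis by blast
qed

lemma valid_sums_old:
  assumes "valid_sums {t \<in> S. \<not> nb t \<subseteq> S \<and> nb t \<subseteq> S \<union> C} g" "\<And>e. e \<subseteq> S \<Longrightarrow> c' e = c e"
    and "\<And>t. t \<in> S \<Longrightarrow> \<not> nb t \<subseteq> S \<Longrightarrow> nb t \<subseteq> S \<union> C \<Longrightarrow> sig c' t = g t"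
    and t: "t \<in> S" "\<not> nb t \<subseteq> S" "nb t \<subseteq> S \<union> C"
  shows "t' \<in> K t \<Longrightarrow> t' \<noteq> t \<Longrightarrow> nb t' \<subseteq> S \<union> C \<Longrightarrow> sig c' t \<noteq> sig c' t'"
    and "avoids c S t \<Longrightarrow> sig c' t \<noteq> \<rho>"
proof -
  let ?P = "{t \<in> S. \<not> nb t \<subseteq> S \<and> nb t \<subseteq> S \<union> C}"
  have tP: "t \<in> ?P" using t by simp
  have gt: "g t \<in> {0..<int k + 1} \<and> (avoids c S t \<longrightarrow> g t \<noteq> \<rho>) \<and>
     (\<forall>t'\<in>K t. t' \<noteq> t \<longrightarrow> t' \<in> ?P \<longrightarrow> g t' \<noteq> g t) \<and> (\<forall>t'\<in>K t. nb t' \<subseteq> S \<longrightarrow> g t \<noteq> sig c t')"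
    using assms(1) tP unfolding valid_sums_def by (rule bspec)
  have sg: "sig c' t = g t" using t by (rule assms(3))
  show "avoids c S t \<Longrightarrow> sig c' t \<noteq> \<rho>" unfolding sg using gt by blast
  assume t': "t' \<in> K t" "t' \<noteq> t" "nb t' \<subseteq> S \<union> C"
  then have t'S: "t' \<in> S" using K_sub t by blast
  show "sig c' t \<noteq> sig c' t'"
  proof (cases "nb t' \<subseteq> S")
    case True
    then have "sig c' t' = sig c t'" using sig_finished assms(2) t'S by blast
    moreover have "g t \<noteq> sig c t'" using gt t' True by blast
    ultimately show ?thesis using sg by simp
  next
    case False
    then have "t' \<in> ?P" using t'S t' by simp
    then have "g t' \<noteq> g t" using gt t' by blast
    moreover have "sig c' t' = g t'" using t'S False t'(3) by (rule assms(3))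
    ultimately show ?thesis using sg by simp
  qed
qed

text \<open>For a vertex not adjacent to \<open>r\<close>, the bound in \<open>slack\<close> is
  \<open>k\<close> instead of \<open>k + 1\<close>; this leaves a residue different from
  \<open>g t0\<close> as well.\<close>

lemma ex_other_valid_sum:
  assumes "valid_sums P g" "P \<subseteq> S - {r}" "\<And>t. t \<in> P \<Longrightarrow> \<not> nb t \<subseteq> S" "t0 \<in> P" "t0 \<notin> nb r"
  shows "\<exists>y. y \<noteq> g t0 \<and> valid_sums P (g(t0 := y))"
proof -
  have t0: "t0 \<in> S" "t0 \<noteq> r" "\<not> nb t0 \<subseteq> S" using assms by auto
  have fin: "finite (K t0)" using finite_K t0 by blast
  define A where "A = (\<lambda>t'. if nb t' \<subseteq> S then sig c t' else g t') ` (K t0 - {t0})"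
  define B where "B = (if avoids c S t0 then {\<rho>} else {}) \<union> {g t0}"
  have "card (A \<union> B) \<le> card A + card B" by (rule card_Un_le)
  also have "card A \<le> card (K t0 - {t0})" unfolding A_def using fin by (intro card_image_le) auto
  also have "card B \<le> of_bool (avoids c S t0) + 1" by (auto simp: B_def card_insert_if)
  also have "card (K t0 - {t0}) = card (K t0) - 1" using K_self[OF t0(1)] by simp
  finally have "card (A \<union> B) \<le> card (K t0) - 1 + (of_bool (avoids c S t0) + 1)" by simp
  moreover have "card (K t0) \<ge> 1" using fin K_self[OF t0(1)] by (metis One_nat_def Suc_leI card_gt_0_iff empty_iff)
  moreover have "card (K t0) + of_bool (avoids c S t0) \<le> k" using slack[OF t0] assms(5) by simp
  ultimately have "card (A \<union> B) < card {0..<int k + 1}" by simp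
  moreover have finAB: "finite (A \<union> B)" using fin by (simp add: A_def B_def)
  ultimately have "\<not> {0..<int k + 1} \<subseteq> A \<union> B"
    using card_mono[of "A \<union> B" "{0..<int k + 1}"] by linarith
  then obtain y where y: "y \<in> {0..<int k + 1}" "y \<notin> A \<union> B" by blast
  have "valid_sums P (g(t0 := y))" unfolding valid_sums_def
  proof
    fix t assume t: "t \<in> P"
    then have g: "g t \<in> {0..<int k + 1}" "avoids c S t \<longrightarrow> g t \<noteq> \<rho>"
      "\<forall>t'\<in>K t. t' \<noteq> t \<longrightarrow> t' \<in> P \<longrightarrow> g t' \<noteq> g t" "\<forall>t'\<in>K t. nb t' \<subseteq> S \<longrightarrow> g t \<noteq> sig c t'"
      using assms(1) unfolding valid_sums_def by blast+
    have tS: "t \<in> S" "\<not> nb t \<subseteq> S" using t assms by auto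
    show "(g(t0 := y)) t \<in> {0..<int k + 1} \<and> (avoids c S t \<longrightarrow> (g(t0 := y)) t \<noteq> \<rho>) \<and>
      (\<forall>t'\<in>K t. t' \<noteq> t \<longrightarrow> t' \<in> P \<longrightarrow> (g(t0 := y)) t' \<noteq> (g(t0 := y)) t) \<and>
      (\<forall>t'\<in>K t. nb t' \<subseteq> S \<longrightarrow> (g(t0 := y)) t \<noteq> sig c t')"
    proof (cases "t = t0")
      case True
      have "y \<noteq> g t'" if "t' \<in> K t0" "t' \<noteq> t0" "t' \<in> P" for t'
        using y(2) that assms(3)[of t'] by (auto simp: A_def)
      moreover have "y \<noteq> sig c t'" if "t' \<in> K t0" "nb t' \<subseteq> S" for t'
        using y(2) that t0(3) by (auto simp: A_def)
      ultimately show ?thesis using True y by (auto simp: B_def)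
    next
      case False
      have "y \<noteq> g t" if "t0 \<in> K t"
      proof -
        have "t \<in> K t0" using K_eq[OF tS(1) that] K_self[OF tS(1)] by simp
        then show ?thesis using y(2) False tS(2) by (auto simp: A_def)
      qed
      then show ?thesis using False g by auto
    qed
  qed
  moreover have "y \<noteq> g t0" using y by (simp add: B_def)
  ultimately show ?thesis by blast
qed

section \<open>Enlarging the set of fixed vertices\<close>

text \<open>The danger is that \<open>w\<close> is completed at once, has maximum degree and
  receives the sum \<open>\<rho>\<close>. Condition \<open>esc\<close> supplies one degree of
  freedom: an edge to a vertex that stays incomplete, whose label is free, or a completed neighbour
  with two admissible sums.\<close>

lemma absorb:
  assumes w: "w \<in> V" "w \<notin> S" "nb w \<inter> S \<noteq> {}" and nr: "nb r \<subseteq> S"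
    and fixw: "\<And>c'' \<phi>. label_aut c'' \<phi> \<Longrightarrow> (\<And>u. u \<in> S \<Longrightarrow> \<phi> u = u) \<Longrightarrow> \<phi> w = w"
    and esc: "nb w \<subseteq> S \<Longrightarrow> card (nb w) = card (nb r) \<Longrightarrow>
      (\<exists>t\<in>nb w. \<not> nb t \<subseteq> insert w S) \<or> (\<exists>t\<in>nb w. t \<notin> nb r)"
  shows "\<exists>c' K'. partial_labeling V E r k \<rho> (S \<union> {w}) c' K' \<and> (\<forall>e. e \<subseteq> S \<longrightarrow> c' e = c e)"
proof -
  let ?n = "int k + 1"
  define P where "P = {t \<in> S. \<not> nb t \<subseteq> S \<and> nb t \<subseteq> S \<union> {w}}"
  have P: "P \<subseteq> S - {r}" "\<And>t. t \<in> P \<Longrightarrow> \<not> nb t \<subseteq> S" using nr by (auto simp: P_def)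
  have Pw: "nb t - S = {w}" "t \<in> nb w" if "t \<in> P" for t using that w nb_sym[of t w] by (auto simp: P_def)
  \<comment> \<open>For a vertex of \<open>P\<close> the edge to \<open>w\<close> is the last one,
    so its label is what the target sum still lacks. The labels of the other edges from
    \<open>w\<close> to \<open>S\<close> are free and given by \<open>x\<close>.\<close>
  define f where "f x g t = (if t \<in> P then (g t - edge_sum c t) mod ?n else x t)" for x g :: "'a \<Rightarrow> int" and t
  have main: ?thesis if g: "valid_sums P g" and x: "\<And>t. x t \<in> {0..<?n}"
    and ok: "nb w \<subseteq> S \<Longrightarrow> card (nb w) = card (nb r) \<Longrightarrow> (\<Sum>t\<in>nb w. f x g t) mod ?n \<noteq> \<rho>" for g x
  proof -
    define c' where "c' e = (if w \<in> e \<and> e \<subseteq> S \<union> {w} then f x g (the_elem (e - {w})) else c e)" for e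
    have frange: "f x g t \<in> {0..<?n}" for t
      using x[of t] mod_range unfolding f_def by simp
    have c'w: "c' {w, t} = f x g t" if "t \<in> S" for t
    proof -
      have "{w, t} - {w} = {t}" using that w by auto
      then show ?thesis using that by (simp add: c'_def)
    qed
    have agree: "c' e = c e" if "e \<subseteq> S" for e using that w by (auto simp: c'_def)
    have sigP: "sig c' t = g t" if "t \<in> P" for t
    proof -
      have "edge_sum c' t = edge_sum c t + f x g t"
        using edge_sum_extend[of c' t] agree Pw[OF that] that c'w[of t] by (simp add: P_def insert_commute)
      then have "sig c' t = g t mod ?n" using that by (simp add: sig_def f_def mod_add_right_eq)
      then show ?thesis using g that by (simp add: valid_sums_def)
    qed
    have "partial_labeling V E r k \<rho> (S \<union> {w}) c' (\<lambda>u. if u \<in> {w} then {u} else K u)"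
    proof (rule extend)
      show "{w} \<subseteq> V" "{w} \<inter> S = {}" using w by auto
      show "nb u \<inter> S \<noteq> {}" if "u \<in> {w}" for u using that w by simp
      show "c' e \<in> {0..<?n}" for e using frange c_range unfolding c'_def by simp
      show "c' e = c e" if "e \<subseteq> S" for e by (rule agree[OF that])
      show "c' e = 0" if "\<not> e \<subseteq> S \<union> {w}" for e using that c_out by (auto simp: c'_def)
      show "sig c' t \<noteq> sig c' t'" if "t \<in> S" "\<not> nb t \<subseteq> S" "nb t \<subseteq> S \<union> {w}" "t' \<in> K t" "t' \<noteq> t" "nb t' \<subseteq> S \<union> {w}" for t t'
        by (rule valid_sums_old(1)[OF g[unfolded P_def] agree]) (use that sigP P_def in auto)
      show "sig c' t \<noteq> \<rho>" if "t \<in> S" "\<not> nb t \<subseteq> S" "nb t \<subseteq> S \<union> {w}" "avoids c S t" for t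
        by (rule valid_sums_old(2)[OF g[unfolded P_def] agree]) (use that sigP P_def in auto)
      show "sig c' u \<noteq> \<rho>" if "u \<in> {w}" "nb u \<subseteq> S \<union> {w}" "avoids c' (S \<union> {w}) u" for u
      proof -
        have "nb w \<subseteq> S" using that nb_irrefl[of w] by auto
        then have "edge_sum c' w = (\<Sum>t\<in>nb w. f x g t)"
          unfolding edge_sum_def by (intro sum.cong) (use c'w in auto)
        then show ?thesis using ok \<open>nb w \<subseteq> S\<close> that by (simp add: sig_def avoids_def)
      qed
      show "card {u} + of_bool (avoids c' (S \<union> {w}) u) \<le> (if u \<in> nb r then k + 1 else k)" for u
        using k2 by simp
      show "\<forall>u\<in>{w}. \<phi> u = u" if "label_aut c'' \<phi>" "\<And>u. u \<in> S \<Longrightarrow> \<phi> u = u" for c'' \<phi>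
        using fixw[OF that] by simp
    qed auto
    then show ?thesis using agree by blast
  qed
  obtain g where g: "valid_sums P g" using ex_valid_sums[OF P] by blast
  show ?thesis
  proof (cases "nb w \<subseteq> S \<and> card (nb w) = card (nb r)")
    case False
    then show ?thesis using main[OF g, of "\<lambda>_. 0"] by auto
  next
    case True
    consider t where "t \<in> nb w" "\<not> nb t \<subseteq> insert w S" | t where "t \<in> nb w" "t \<notin> nb r" "t \<in> P"
      using esc True unfolding P_def using nb_sym[of _ w] w(2) by fastforce
    then show ?thesis
    proof cases
      case 1
      then have tP: "t \<notin> P" by (auto simp: P_def)
      have s: "(\<Sum>y\<in>nb w. f ((\<lambda>_. 0)(t := d)) g y) = d + (\<Sum>y\<in>nb w - {t}. f (\<lambda>_. 0) g y)" for d
      proof -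
        have "(\<Sum>y\<in>nb w. f ((\<lambda>_. 0)(t := d)) g y) = f ((\<lambda>_. 0)(t := d)) g t + (\<Sum>y\<in>nb w - {t}. f ((\<lambda>_. 0)(t := d)) g y)"
          using 1 by (simp add: sum.remove)
        moreover have "(\<Sum>y\<in>nb w - {t}. f ((\<lambda>_. 0)(t := d)) g y) = (\<Sum>y\<in>nb w - {t}. f (\<lambda>_. 0) g y)"
          by (rule sum.cong) (auto simp: f_def)
        ultimately show ?thesis using tP by (simp add: f_def)
      qed
      have "\<exists>d\<in>{0, 1}. (d + (\<Sum>y\<in>nb w - {t}. f (\<lambda>_. 0) g y)) mod ?n \<noteq> \<rho>"
      proof (rule ccontr)
        assume "\<not> ?thesis"
        then have "(1 + (\<Sum>y\<in>nb w - {t}. f (\<lambda>_. 0) g y)) mod ?n = (0 + (\<Sum>y\<in>nb w - {t}. f (\<lambda>_. 0) g y)) mod ?n" by simp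
        then have "?n dvd 1" by (simp add: mod_eq_dvd_iff)
        then show False using k2 by (simp add: zdvd_not_zless)
      qed
      then obtain d where d: "d \<in> {0, 1}" "(d + (\<Sum>y\<in>nb w - {t}. f (\<lambda>_. 0) g y)) mod ?n \<noteq> \<rho>" by blast
      show ?thesis
        by (rule main[OF g, of "(\<lambda>_. 0)(t := d)"]) (use d k2 s in auto)
    next
      case 2
      obtain y where y: "y \<noteq> g t" "valid_sums P (g(t := y))"
        using ex_other_valid_sum[OF g P 2(3,2)] by blast
      define s where "s = (\<Sum>z\<in>nb w - {t}. f (\<lambda>_. 0) g z)"
      have s: "(\<Sum>z\<in>nb w. f (\<lambda>_. 0) (g(t := q)) z) mod ?n = ((q - edge_sum c t) + s) mod ?n" for q
      proof -
        have "(\<Sum>z\<in>nb w. f (\<lambda>_. 0) (g(t := q)) z) = f (\<lambda>_. 0) (g(t := q)) t + (\<Sum>z\<in>nb w - {t}. f (\<lambda>_. 0) (g(t := q)) z)"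
          using 2 by (simp add: sum.remove)
        moreover have "(\<Sum>z\<in>nb w - {t}. f (\<lambda>_. 0) (g(t := q)) z) = s" unfolding s_def
          by (rule sum.cong) (auto simp: f_def)
        ultimately show ?thesis using 2 by (simp add: f_def mod_add_left_eq)
      qed
      have "\<exists>q\<in>{g t, y}. (\<Sum>z\<in>nb w. f (\<lambda>_. 0) (g(t := q)) z) mod ?n \<noteq> \<rho>"
      proof (rule ccontr)
        assume "\<not> ?thesis"
        then have "((y - edge_sum c t) + s) mod ?n = ((g t - edge_sum c t) + s) mod ?n" using s by simp
        then have "?n dvd y - g t" by (simp add: mod_eq_dvd_iff)
        moreover have "y \<in> {0..<?n}" "g t \<in> {0..<?n}" using y(2) g 2(3) by (auto simp: valid_sums_def)
        ultimately show False using y(1) by (auto dest!: zdvd_imp_le[of _ "\<bar>y - g t\<bar>", simplified])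
      qed
      then obtain q where q: "q \<in> {g t, y}" "(\<Sum>z\<in>nb w. f (\<lambda>_. 0) (g(t := q)) z) mod ?n \<noteq> \<rho>" by blast
      then have "valid_sums P (g(t := q))" using g y by auto
      then show ?thesis by (rule main[of "g(t := q)" "\<lambda>_. 0"]) (use q in auto)
    qed
  qed
qed

text \<open>The pairs of labels at \<open>v\<close> and \<open>s\<close> already separate
  \<open>C\<close>, so all new classes are singletons. The sums in \<open>C\<close> only have to
  avoid \<open>\<rho>\<close>, and the labels not at \<open>v\<close> or \<open>s\<close> are used
  for that.\<close>

lemma absorb_common:
  assumes v: "v \<in> S" and s: "s \<in> S" "s \<noteq> v" and C: "C = nb v - S" "nb s - S = C" "card C \<ge> 2"
    and nr: "nb r \<subseteq> S"
    and minimal: "\<And>t. t \<in> S \<Longrightarrow> \<not> nb t \<subseteq> S \<Longrightarrow> nb t \<subseteq> S \<union> C \<Longrightarrow> nb t - S = C"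
  shows "\<exists>c' K'. partial_labeling V E r k \<rho> (S \<union> C) c' K' \<and> (\<forall>e. e \<subseteq> S \<longrightarrow> c' e = c e)"
proof -
  let ?n = "int k + 1"
  have CV: "C \<subseteq> V" "C \<inter> S = {}" "finite C" using C nb_sub by auto
  have n3: "?n \<ge> 3" using k2 by simp
  define P where "P = {t \<in> S. \<not> nb t \<subseteq> S \<and> nb t \<subseteq> S \<union> C}"
  have P: "P \<subseteq> S - {r}" "\<And>t. t \<in> P \<Longrightarrow> \<not> nb t \<subseteq> S" using nr by (auto simp: P_def)
  have PC: "nb t - S = C" if "t \<in> P" for t using that minimal by (auto simp: P_def)
  have Cne: "C \<noteq> {}" using C(3) by (cases "C = {}") simp_all
  have vP: "v \<in> P" "s \<in> P" using v s C Cne by (auto simp: P_def)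
  obtain g where g: "valid_sums P g" using ex_valid_sums[OF P] by blast
  have "nb v \<inter> S \<noteq> {}" using parent[OF v] vP P by auto
  then obtain y where y: "y \<in> nb v" "y \<in> S" by blast
  have deg_v: "card C + 1 \<le> card (nb v)"
  proof -
    have "card (insert y C) \<le> card (nb v)" using y C CV by (intro card_mono) auto
    then show ?thesis using y C CV by simp
  qed
  moreover have "card (nb v) \<le> card (nb r)" using v S_sub max_deg by blast
  ultimately have card_r: "card C + 1 \<le> card (nb r)" by simp
  then have "card C \<le> k\<^sup>2 - 1" using max_deg_le by simp
  then obtain \<alpha> \<beta> :: "'a \<Rightarrow> int" where ab: "\<And>u. u \<in> C \<Longrightarrow> \<alpha> u \<in> {0..<?n} \<and> \<beta> u \<in> {0..<?n}"
    "inj_on (\<lambda>u. (\<alpha> u, \<beta> u)) C"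
    "(\<Sum>u\<in>C. \<alpha> u) mod ?n = (g v - edge_sum c v) mod ?n" "(\<Sum>u\<in>C. \<beta> u) mod ?n = (g s - edge_sum c s) mod ?n"
    using distinct_pairs_sums[OF k2 CV(3) C(3), of "g v - edge_sum c v" "g s - edge_sum c s"] by blast
  obtain u0 where u0: "u0 \<in> C" using Cne by blast
  \<comment> \<open>A vertex of \<open>P\<close> other than \<open>v\<close> and \<open>s\<close>
    reaches its target through the single edge to \<open>u0\<close>; its other new edges get
    0.\<close>
  define f where "f t u = (if t = v then \<alpha> u else if t = s then \<beta> u else if u = u0 then (g t - edge_sum c t) mod ?n else 0)" for t u
  define c0 where "c0 e = (if \<exists>t\<in>P. \<exists>u\<in>C. e = {t, u} then f (the_elem (e \<inter> S)) (the_elem (e \<inter> C)) else c e)" for e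
  \<comment> \<open>Everything that is required except avoiding \<open>\<rho>\<close> in
    \<open>C\<close>. The repairs below stay inside this family.\<close>
  define good where "good c' \<longleftrightarrow> (\<forall>e. c' e \<in> {0..<?n}) \<and> (\<forall>e. e \<subseteq> S \<longrightarrow> c' e = c e) \<and> (\<forall>e. \<not> e \<subseteq> S \<union> C \<longrightarrow> c' e = 0) \<and>
    (\<forall>t\<in>P. sig c' t = g t) \<and> (\<forall>u\<in>C. c' {v, u} = \<alpha> u \<and> c' {s, u} = \<beta> u)" for c'
  have c0P: "c0 {t, u} = f t u" if "t \<in> P" "u \<in> C" for t u
  proof -
    have "{t, u} \<inter> S = {t}" "{t, u} \<inter> C = {u}" using that CV P by auto
    then show ?thesis using that by (auto simp: c0_def)
  qed
  have f_range: "f t u \<in> {0..<?n}" if "u \<in> C" for t u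
    using ab(1)[OF that] mod_range n3 unfolding f_def by auto
  have "good c0" unfolding good_def
  proof (intro conjI allI impI ballI)
    show "c0 e \<in> {0..<?n}" for e
    proof (cases "\<exists>t\<in>P. \<exists>u\<in>C. e = {t, u}")
      case True
      then obtain t u where "t \<in> P" "u \<in> C" "e = {t, u}" by blast
      then show ?thesis using c0P f_range by simp
    next
      case False
      then show ?thesis using c_range by (simp only: c0_def if_False)
    qed
    show agree: "c0 e = c e" if "e \<subseteq> S" for e using that CV by (auto simp: c0_def)
    show "c0 e = 0" if "\<not> e \<subseteq> S \<union> C" for e using that P c_out by (auto simp: c0_def)
    show "c0 {v, u} = \<alpha> u" if "u \<in> C" for u using c0P[OF vP(1) that] by (simp add: f_def)
    show "c0 {s, u} = \<beta> u" if "u \<in> C" for u using c0P[OF vP(2) that] s by (simp add: f_def)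
    show "sig c0 t = g t" if t: "t \<in> P" for t
    proof -
      have "edge_sum c0 t = edge_sum c t + (\<Sum>u\<in>C. f t u)"
        using edge_sum_extend[of c0 t] agree t P PC[OF t] c0P[OF t] by auto
      moreover have "(\<Sum>u\<in>C. f t u) mod ?n = (g t - edge_sum c t) mod ?n"
      proof -
        consider "t = v" | "t = s" "t \<noteq> v" | "t \<noteq> v" "t \<noteq> s" by blast
        then show ?thesis
        proof cases
          case 3
          then show ?thesis using CV u0 by (simp add: f_def)
        qed (use ab in \<open>simp_all add: f_def\<close>)
      qed
      ultimately have "sig c0 t = (edge_sum c t + (g t - edge_sum c t)) mod ?n"
        unfolding sig_def by (metis mod_add_right_eq)
      then show ?thesis using g t by (simp add: valid_sums_def)
    qed
  qed
  txt \<open>A labeling with the fewest forbidden sums has none: one can be repaired by a local shift.\<close>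
  define bad where "bad c' = {u \<in> C. nb u \<subseteq> S \<union> C \<and> card (nb u) = card (nb r) \<and> sig c' u = \<rho>}" for c'
  obtain c' where c': "good c'" "\<And>c''. good c'' \<Longrightarrow> card (bad c') \<le> card (bad c'')"
    using ex_has_least_nat[of good c0 "\<lambda>c'. card (bad c')"] \<open>good c0\<close> by blast
  have "bad c' = {}"
  proof (rule ccontr)
    assume "bad c' \<noteq> {}"
    then obtain u where u: "u \<in> bad c'" by blast
    then have uC: "u \<in> C" "nb u \<subseteq> S \<union> C" "card (nb u) = card (nb r)" "sig c' u = \<rho>" by (auto simp: bad_def)
    \<comment> \<open>\<open>h\<close> alters the sums of \<open>u\<close> and one more vertex
      \<open>u'\<close> by a unit and no other sum in \<open>C\<close> or \<open>P\<close>. Adding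
      \<open>h\<close> or \<open>2 * h\<close> moves \<open>u\<close> off \<open>\<rho>\<close>
      because \<open>k + 1 \<ge> 3\<close>, and at least one of the two leaves \<open>u'\<close> off
      \<open>\<rho>\<close>.\<close>
    have improve: False if h: "\<And>e. e \<subseteq> S \<Longrightarrow> h e = 0" "\<And>e. \<not> e \<subseteq> S \<union> C \<Longrightarrow> h e = 0"
      "\<And>x. x \<in> C \<Longrightarrow> h {v, x} = 0 \<and> h {s, x} = 0" "\<And>t. t \<in> P \<Longrightarrow> edge_sum h t = 0"
      "edge_sum h u = 1" and u': "u' \<noteq> u" "edge_sum h u' = 1 \<or> edge_sum h u' = -1"
      "\<And>x. x \<in> C \<Longrightarrow> x \<noteq> u \<Longrightarrow> x \<noteq> u' \<Longrightarrow> edge_sum h x = 0" for h u'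
    proof -
      define c'' where "c'' d e = (c' e + d * h e) mod ?n" for d e
      have es: "edge_sum (\<lambda>e. d * h e) x = d * edge_sum h x" for d x by (simp add: edge_sum_def sum_distrib_left)
      have sg: "sig (c'' d) x = (edge_sum c' x + d * edge_sum h x) mod ?n" for d x
        unfolding c''_def sig_mod edge_sum_add es ..
      have sg0: "sig (c'' d) x = sig c' x" if "edge_sum h x = 0" for d x using that by (simp add: sg) (simp add: sig_def)
      have cr: "c' e mod ?n = c' e" for e using c'(1) unfolding good_def by simp
      have same: "c'' d e = c' e" if "h e = 0" for d e using cr[of e] that by (simp add: c''_def)
      have rng: "c'' d e \<in> {0..<?n}" for d e unfolding c''_def by (rule mod_range)
      have good: "good (c'' d)" for d unfolding good_def
        using c'(1) h(1-4) sg0 same rng unfolding good_def by simp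
      have "\<exists>d\<in>{1, 2}. sig (c'' d) u' \<noteq> \<rho>"
      proof (rule ccontr)
        assume "\<not> ?thesis"
        then have "(edge_sum c' u' + 2 * edge_sum h u') mod ?n = (edge_sum c' u' + edge_sum h u') mod ?n"
          unfolding sg by simp
        then have "?n dvd edge_sum h u'" by (simp add: mod_eq_dvd_iff)
        then have "?n dvd 1" using u'(2) by auto
        then show False using n3 by (simp add: zdvd_not_zless)
      qed
      then obtain d where d: "d \<in> {1, 2}" "sig (c'' d) u' \<noteq> \<rho>" by blast
      have "sig (c'' d) u \<noteq> \<rho>"
      proof
        assume "sig (c'' d) u = \<rho>"
        then have "(edge_sum c' u + d) mod ?n = edge_sum c' u mod ?n" using uC(4) h(5) sg by (simp add: sig_def)
        then have "?n dvd d" by (simp add: mod_eq_dvd_iff)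
        then show False using d n3 by (auto simp: zdvd_not_zless)
      qed
      have "bad (c'' d) \<subseteq> bad c' - {u}"
      proof
        fix x assume "x \<in> bad (c'' d)"
        then have x: "x \<in> C" "nb x \<subseteq> S \<union> C" "card (nb x) = card (nb r)" "sig (c'' d) x = \<rho>" by (simp_all add: bad_def)
        then have "x \<noteq> u" "x \<noteq> u'" using d(2) \<open>sig (c'' d) u \<noteq> \<rho>\<close> by auto
        then have "sig c' x = \<rho>" using sg0[OF u'(3)] x by simp
        then show "x \<in> bad c' - {u}" using x \<open>x \<noteq> u\<close> by (simp add: bad_def)
      qed
      then have "card (bad (c'' d)) \<le> card (bad c' - {u})" using CV by (intro card_mono) (auto simp: bad_def)
      moreover have "card (bad c' - {u}) < card (bad c')"
        using u CV by (intro psubset_card_mono) (auto simp: bad_def)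
      ultimately show False using c'(2)[OF good[of d]] by simp
    qed
    have uv: "u \<noteq> v" "u \<noteq> s" using uC CV v s by auto
    show False
    proof (cases "nb u \<inter> (S - P) = {} \<and> nb u \<inter> C = {}")
      case False
      \<comment> \<open>The vertex \<open>t\<close> has no target sum, so the label of the single
        edge between \<open>u\<close> and \<open>t\<close> may be changed.\<close>
      then obtain t where t: "t \<in> nb u" "t \<in> (S - P) \<union> C" by blast
      let ?h = "\<lambda>e. if e = {u, t} then 1 else 0 :: int"
      have tn: "t \<noteq> u" using t by auto
      have tP: "t \<notin> P" using t CV P by auto
      show False
      proof (rule improve[of ?h t])
        show "?h e = 0" if "e \<subseteq> S" for e using that uC CV by auto
        show "?h e = 0" if "\<not> e \<subseteq> S \<union> C" for e using that uC t by auto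
        show "?h {v, x} = 0 \<and> ?h {s, x} = 0" if "x \<in> C" for x
          using that vP tP uv by (auto simp: doubleton_eq_iff)
        show "edge_sum ?h x = 0" if "x \<in> P" for x
          unfolding edge_sum_single[OF t(1)] using that tP uC CV P by auto
        show "edge_sum ?h x = 0" if "x \<in> C" "x \<noteq> u" "x \<noteq> t" for x
          unfolding edge_sum_single[OF t(1)] using that by auto
        show "edge_sum ?h u = 1" "edge_sum ?h t = 1 \<or> edge_sum ?h t = -1"
          unfolding edge_sum_single[OF t(1)] by auto
      qed (rule tn)
    next
      case True
      \<comment> \<open>All neighbours of \<open>u\<close> have target sums. There are at least
        \<open>card C + 1 \<ge> 3\<close> of them, so one is neither \<open>v\<close> nor
        \<open>s\<close>; the change is passed on through it to another vertex of
        \<open>C\<close>.\<close>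
      then have "nb u = P"
        using uC PC nb_sym P by blast
      then have "card P \<ge> 3" using uC card_r C(3) by simp
      then have "\<not> P \<subseteq> {v, s}" using card_mono[of "{v, s}" P] s by auto
      then obtain t where t: "t \<in> P" "t \<noteq> v" "t \<noteq> s" by blast
      have "\<not> C \<subseteq> {u}" using C(3) card_mono[of "{u}" C] by auto
      then obtain u' where u': "u' \<in> C" "u' \<noteq> u" by blast
      have tu: "u \<in> nb t" "u' \<in> nb t" using PC[OF t(1)] uC u' by auto
      have tC: "t \<in> S" "t \<notin> C" using t P CV by auto
      let ?h = "\<lambda>e. (if e = {t, u} then 1 else 0) + (if e = {t, u'} then -1 else 0) :: int"
      have es: "edge_sum ?h x = (if x = t \<or> x = u then 1 else 0) + (if x = t \<or> x = u' then -1 else 0)" for x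
        unfolding edge_sum_add edge_sum_single[OF tu(1)] edge_sum_single[OF tu(2)] ..
      show False
      proof (rule improve[of ?h u'])
        show "?h e = 0" if "e \<subseteq> S" for e using that uC u' CV by auto
        show "?h e = 0" if "\<not> e \<subseteq> S \<union> C" for e using that uC u' tC by auto
        show "?h {v, x} = 0 \<and> ?h {s, x} = 0" if "x \<in> C" for x
          using that uC u' t tC v s CV by (auto simp: doubleton_eq_iff)
        show "edge_sum ?h x = 0" if "x \<in> P" for x
          unfolding es using that uC u' CV P by auto
        show "edge_sum ?h u = 1" unfolding es using u' tC uC by auto
        show "edge_sum ?h u' = 1 \<or> edge_sum ?h u' = -1" unfolding es using u' tC by auto
        show "edge_sum ?h x = 0" if "x \<in> C" "x \<noteq> u" "x \<noteq> u'" for x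
          unfolding es using that tC by auto
      qed (rule u'(2))
    qed
  qed
  have agree: "\<And>e. e \<subseteq> S \<Longrightarrow> c' e = c e" and sigP: "\<And>t. t \<in> P \<Longrightarrow> sig c' t = g t" using c'(1) by (auto simp: good_def)
  have "partial_labeling V E r k \<rho> (S \<union> C) c' (\<lambda>u. if u \<in> C then {u} else K u)"
  proof (rule extend)
    show "C \<subseteq> V" "C \<inter> S = {}" using CV by auto
    show "nb u \<inter> S \<noteq> {}" if "u \<in> C" for u using that C v nb_sym by blast
    show "c' e \<in> {0..<?n}" for e using c'(1) by (simp add: good_def)
    show "c' e = c e" if "e \<subseteq> S" for e by (rule agree[OF that])
    show "c' e = 0" if "\<not> e \<subseteq> S \<union> C" for e using c'(1) that by (simp add: good_def)
    show "sig c' t \<noteq> sig c' t'" if "t \<in> S" "\<not> nb t \<subseteq> S" "nb t \<subseteq> S \<union> C" "t' \<in> K t" "t' \<noteq> t" "nb t' \<subseteq> S \<union> C" for t t'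
      by (rule valid_sums_old(1)[OF g[unfolded P_def] agree]) (use that sigP P_def in auto)
    show "sig c' t \<noteq> \<rho>" if "t \<in> S" "\<not> nb t \<subseteq> S" "nb t \<subseteq> S \<union> C" "avoids c S t" for t
      by (rule valid_sums_old(2)[OF g[unfolded P_def] agree]) (use that sigP P_def in auto)
    show "sig c' u \<noteq> \<rho>" if "u \<in> C" "nb u \<subseteq> S \<union> C" "avoids c' (S \<union> C) u" for u
      using \<open>bad c' = {}\<close> that by (auto simp: bad_def avoids_def)
    show "card {u} + of_bool (avoids c' (S \<union> C) u) \<le> (if u \<in> nb r then k + 1 else k)" for u
      using k2 by simp
    show "\<forall>u\<in>C. \<phi> u = u" if c'': "\<And>e. e \<subseteq> S \<union> C \<Longrightarrow> c'' e = c' e" and \<phi>: "label_aut c'' \<phi>" and fx: "\<And>u. u \<in> S \<Longrightarrow> \<phi> u = u" for c'' \<phi>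
    proof
      fix u assume u: "u \<in> C"
      then have uv: "u \<in> nb v" "u \<in> nb s" "u \<in> V" "u \<notin> S" using C CV by auto
      have vV: "v \<in> V" "s \<in> V" using v s S_sub by auto
      have n: "\<phi> u \<in> nb v" using label_aut_edge[OF \<phi> vV(1) uv(3)] fx v uv by simp
      have "\<phi> u \<notin> S"
      proof
        assume a: "\<phi> u \<in> S"
        then have "\<phi> (\<phi> u) = \<phi> u" by (rule fx)
        then have "\<phi> u = u" using label_aut_inj[OF \<phi>] a S_sub uv by blast
        then show False using a uv by simp
      qed
      then have \<phi>C: "\<phi> u \<in> C" using n C by simp
      have "c'' {v, \<phi> u} = c'' {v, u}" "c'' {s, \<phi> u} = c'' {s, u}"
        using label_aut_label[OF \<phi>, of u v] label_aut_label[OF \<phi>, of u s] uv fx v s by simp_all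
      then have "\<alpha> (\<phi> u) = \<alpha> u" "\<beta> (\<phi> u) = \<beta> u"
        using c'' c'(1) u \<phi>C v s unfolding good_def by auto
      then show "\<phi> u = u" using ab(2) u \<phi>C by (auto simp: inj_on_def)
    qed
  qed auto
  then show ?thesis using agree by blast
qed

end

section \<open>Components of the graph induced on a new layer\<close>

context rooted_graph
begin

definition inner_edges :: "'a set \<Rightarrow> ('a \<times> 'a) set" where
  "inner_edges C = {(x, y). x \<in> C \<and> y \<in> C \<and> y \<in> nb x}"

text \<open>The remaining vertices of \<open>C\<close> form components of the graph induced on \<open>C\<close> all of whose
  edges leaving the component go to \<open>v\<close>. In each of them one vertex has a sum that cannot be
  prescribed.\<close>

definition outward :: "'a \<Rightarrow> 'a set \<Rightarrow> 'a set" where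
  "outward v C = {u \<in> C. \<exists>f\<in>C. (u, f) \<in> (inner_edges C)\<^sup>* \<and> \<not> nb f \<subseteq> insert v C}"

lemma inner_edges_sym: "(x, y) \<in> (inner_edges C)\<^sup>* \<Longrightarrow> (y, x) \<in> (inner_edges C)\<^sup>*"
  by (rule symD[OF sym_rtrancl]) (auto simp: inner_edges_def sym_def nb_sym)

lemma inner_edges_closed: "(x, y) \<in> (inner_edges C)\<^sup>* \<Longrightarrow> x \<in> C \<Longrightarrow> y \<in> C"
  by (induction rule: rtrancl_induct) (auto simp: inner_edges_def)

lemma outward_step: "(u, u') \<in> (inner_edges C)\<^sup>* \<Longrightarrow> u \<in> C \<Longrightarrow> u' \<in> outward v C \<Longrightarrow> u \<in> outward v C"
  unfolding outward_def by (auto intro: rtrancl_trans)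

lemma nb_not_outward:
  assumes "u \<in> C - outward v C"
  shows "nb u \<subseteq> insert v C" "\<And>z. z \<in> nb u \<Longrightarrow> z \<in> C \<Longrightarrow> z \<in> C - outward v C \<and> (u, z) \<in> (inner_edges C)\<^sup>*"
proof -
  show "nb u \<subseteq> insert v C" using assms by (auto simp: outward_def)
  fix z assume z: "z \<in> nb u" "z \<in> C"
  then have "(u, z) \<in> (inner_edges C)\<^sup>*" using assms by (auto simp: inner_edges_def)
  moreover have "z \<notin> outward v C" using outward_step[OF calculation] assms by blast
  ultimately show "z \<in> C - outward v C \<and> (u, z) \<in> (inner_edges C)\<^sup>*" using z by blast
qed

text \<open>The chosen vertex depends only on the set of reachable vertices, so it is the same
  throughout a component.\<close>

lemma ex_representatives:
  assumes "\<And>u. u \<in> Z \<Longrightarrow> \<exists>w\<in>Z. (u, w) \<in> (inner_edges C)\<^sup>* \<and> Q w"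
  shows "\<exists>X\<subseteq>Z. (\<forall>u\<in>Z. \<exists>w\<in>X. (u, w) \<in> (inner_edges C)\<^sup>*) \<and>
    (\<forall>w\<in>X. \<forall>w'\<in>X. (w, w') \<in> (inner_edges C)\<^sup>* \<longrightarrow> w = w') \<and> (\<forall>w\<in>X. Q w)"
proof -
  define pick where "pick u = (SOME w. w \<in> Z \<and> (u, w) \<in> (inner_edges C)\<^sup>* \<and> Q w)" for u
  have pick: "pick u \<in> Z \<and> (u, pick u) \<in> (inner_edges C)\<^sup>* \<and> Q (pick u)" if "u \<in> Z" for u
    unfolding pick_def by (rule someI_ex) (use assms[OF that] in blast)
  have same: "pick u = pick u'" if "(u, u') \<in> (inner_edges C)\<^sup>*" for u u'
  proof -
    have "(u, w) \<in> (inner_edges C)\<^sup>* \<longleftrightarrow> (u', w) \<in> (inner_edges C)\<^sup>*" for w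
      using that inner_edges_sym rtrancl_trans by metis
    then show ?thesis by (simp add: pick_def)
  qed
  show ?thesis
  proof (intro exI[of _ "pick ` Z"] conjI ballI impI)
    show "pick ` Z \<subseteq> Z" using pick by blast
    show "\<exists>w\<in>pick ` Z. (u, w) \<in> (inner_edges C)\<^sup>*" if "u \<in> Z" for u using pick[OF that] that by blast
    show "Q w" if "w \<in> pick ` Z" for w using pick that by blast
    show "w = w'" if w: "w \<in> pick ` Z" "w' \<in> pick ` Z" "(w, w') \<in> (inner_edges C)\<^sup>*" for w w'
    proof -
      obtain u u' where u: "u \<in> Z" "u' \<in> Z" "w = pick u" "w' = pick u'" using w(1,2) by blast
      have "(u, w) \<in> (inner_edges C)\<^sup>*" "(u', w') \<in> (inner_edges C)\<^sup>*" using pick u by auto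
      then have "(u, u') \<in> (inner_edges C)\<^sup>*"
        by (meson rtrancl_trans inner_edges_sym w(3))
      then show ?thesis using same u by simp
    qed
  qed
qed

end

section \<open>Adding a layer that completes a single old vertex\<close>

context partial_labeling
begin

text \<open>Since \<open>v\<close> is the only old vertex completed, the sums of the completed
  vertices in \<open>C - X\<close> can be prescribed: corrections run along walks avoiding
  \<open>v\<close> until they meet an incomplete vertex or a representative in \<open>X\<close>. The
  sums in \<open>X\<close> are given up, so these vertices must not have maximum degree, and their
  labels at \<open>v\<close> must differ from those in the rest of their components.\<close>

lemma expand:
  assumes v: "v \<in> S" and C: "C = nb v - S"
    and others: "\<And>t. t \<in> S \<Longrightarrow> t \<noteq> v \<Longrightarrow> nb t \<inter> C \<noteq> {} \<Longrightarrow> \<not> nb t \<subseteq> S \<union> C"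
    and X: "X \<subseteq> C - outward v C" "\<And>u. u \<in> C - outward v C \<Longrightarrow> \<exists>w\<in>X. (u, w) \<in> (inner_edges C)\<^sup>*"
      "\<And>w w'. w \<in> X \<Longrightarrow> w' \<in> X \<Longrightarrow> (w, w') \<in> (inner_edges C)\<^sup>* \<Longrightarrow> w = w'"
      "\<And>w. w \<in> X \<Longrightarrow> card (nb w) \<noteq> card (nb r)"
    and a: "\<And>u. u \<in> C \<Longrightarrow> a u \<in> {0..<int k + 1}" "\<And>u w. u \<in> C - outward v C - X \<Longrightarrow> w \<in> X \<Longrightarrow> a u \<noteq> a w"
    and sum: "\<And>t'. t' \<in> K v \<Longrightarrow> t' \<noteq> v \<Longrightarrow> nb t' \<subseteq> S \<Longrightarrow> (edge_sum c v + (\<Sum>u\<in>C. a u)) mod (int k + 1) \<noteq> sig c t'"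
      "v \<noteq> r \<Longrightarrow> avoids c S v \<Longrightarrow> (edge_sum c v + (\<Sum>u\<in>C. a u)) mod (int k + 1) \<noteq> \<rho>"
    and rows: "\<And>u. u \<in> outward v C \<Longrightarrow> card {u' \<in> outward v C. a u' = a u} +
        of_bool (card (nb u) = card (nb r) \<and> \<not> (a u = 0 \<and> card (nb v) = card (nb r))) \<le> (if u \<in> nb r then k + 1 else k)"
      "\<And>u. u \<in> C - outward v C - X \<Longrightarrow> card {u' \<in> C - outward v C - X. a u' = a u} +
        of_bool (card (nb u) = card (nb r) \<and> \<not> (a u = 0 \<and> card (nb v) = card (nb r))) \<le> k + 1"
  shows "\<exists>c' K'. partial_labeling V E r k \<rho> (S \<union> C) c' K' \<and> (\<forall>e. e \<subseteq> S \<longrightarrow> c' e = c e) \<and>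
    sig c' v = (edge_sum c v + (\<Sum>u\<in>C. a u)) mod (int k + 1) \<and> (\<forall>u\<in>C. c' {v, u} = a u)"
proof -
  let ?n = "int k + 1"
  define U where "U = outward v C"
  define Y where "Y = C - outward v C - X"
  have CV: "C \<subseteq> V" "C \<inter> S = {}" "finite C" "v \<notin> C" using C v nb_sub by auto
  have UC: "U \<subseteq> C" by (auto simp: U_def outward_def)
  have XC: "X \<subseteq> C" using X by auto
  have Xfin: "nb w \<subseteq> S \<union> C" if "w \<in> X" for w using X(1) that nb_not_outward(1)[of w C v] v by auto
  have split: "u \<in> U \<or> u \<in> Y \<or> u \<in> X" if "u \<in> C" for u using that by (auto simp: U_def Y_def)
  have disj: "U \<inter> Y = {}" "U \<inter> X = {}" "Y \<inter> X = {}" using X by (auto simp: U_def Y_def)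
  \<comment> \<open>Rows inside and outside \<open>U\<close> need no separation by sums, because
    \<open>U\<close> is preserved by every automorphism fixing \<open>S\<close>.\<close>
  define K' where "K' u = (if u \<in> X then {u} else if u \<in> U then {u' \<in> U. a u' = a u} else {u' \<in> Y. a u' = a u})" for u
  \<comment> \<open>A necessary condition for \<open>avoids\<close> after this step that depends on
    the labels at \<open>v\<close> only, and is thus known before the other labels are
    chosen.\<close>
  define crit where "crit u \<longleftrightarrow> card (nb u) = card (nb r) \<and> \<not> (a u = 0 \<and> card (nb v) = card (nb r))" for u
  define T where "T = {u \<in> C - X. nb u \<subseteq> S \<union> C}"
  have K'_props: "u \<in> K' u" "K' u \<subseteq> C" "\<And>u'. u' \<in> K' u \<Longrightarrow> K' u' = K' u" if "u \<in> C" for u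
    using split[OF that] disj UC XC by (auto simp: K'_def Y_def)
  have K'_row: "card (K' u) + of_bool (crit u) \<le> k + 1" if "u \<in> C - X" for u
  proof (cases "u \<in> U")
    case True
    then show ?thesis using rows(1)[of u] that unfolding K'_def U_def crit_def by (auto split: if_splits)
  next
    case False
    then have "u \<in> Y" using split that by blast
    then show ?thesis using rows(2)[of u] that False unfolding K'_def U_def Y_def crit_def by auto
  qed
  have "\<exists>b. \<forall>u\<in>T. b u \<in> {0..<int (k + 1)} \<and> b u \<notin> (if crit u then {\<rho>} else {}) \<and> (\<forall>u'\<in>K' u \<inter> T. u' \<noteq> u \<longrightarrow> b u \<noteq> b u')"
  proof (rule greedy_choice)
    show "finite T" using CV by (simp add: T_def)
    show "u \<in> K' u'" if "u \<in> T" "u' \<in> T" "u' \<in> K' u" for u u'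
    proof -
      have "u \<in> C" using that by (simp add: T_def)
      then have "K' u' = K' u" "u \<in> K' u" using K'_props that(3) by blast+
      then show ?thesis by simp
    qed
    show "finite (if crit u then {\<rho>} else {}) \<and> card (if crit u then {\<rho>} else {}) + card (K' u \<inter> T - {u}) < k + 1"
      if u: "u \<in> T" for u
    proof -
      have uC: "u \<in> C" "u \<in> C - X" using u by (auto simp: T_def)
      have fin: "finite (K' u)" using K'_props(2)[OF uC(1)] CV finite_subset by blast
      have "card (K' u \<inter> T - {u}) < card (K' u)"
        using fin K'_props(1)[OF uC(1)] by (intro psubset_card_mono) auto
      then show ?thesis using K'_row[OF uC(2)] by (auto split: if_splits)
    qed
  qed
  moreover have "int (k + 1) = ?n" by simp
  ultimately obtain b where b: "\<forall>u\<in>T. b u \<in> {0..<?n} \<and> b u \<notin> (if crit u then {\<rho>} else {}) \<and> (\<forall>u'\<in>K' u \<inter> T. u' \<noteq> u \<longrightarrow> b u \<noteq> b u')"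
    by metis
  define c0 where "c0 e = (if \<exists>u\<in>C. e = {v, u} then a (the_elem (e - {v})) else c e)" for e
  have c0v: "c0 {v, u} = a u" if "u \<in> C" for u
  proof -
    have "{v, u} - {v} = {u}" using that CV by auto
    then show ?thesis using that by (auto simp: c0_def)
  qed
  \<comment> \<open>Corrections may use neither edges at \<open>v\<close> nor edges inside
    \<open>S\<close>. They may end in \<open>R\<close>, which contains the incomplete vertices and
    the representatives \<open>X\<close>.\<close>
  define M where "M = {e \<in> E. e \<inter> C \<noteq> {} \<and> e \<subseteq> C \<union> (S - {v})}"
  define R where "R = - (T \<union> {x \<in> S. nb x \<subseteq> S \<union> C})"
  have path: "(u, f) \<in> {(x, y). {x, y} \<in> M}\<^sup>*" if "(u, f) \<in> (inner_edges C)\<^sup>*" for u f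
  proof -
    have "inner_edges C \<subseteq> {(x, y). {x, y} \<in> M}" by (auto simp: inner_edges_def M_def nb_def)
    then show ?thesis using that rtrancl_mono by blast
  qed
  have reach: "\<exists>x\<in>R. (u, x) \<in> {(x, y). {x, y} \<in> M}\<^sup>*" if u: "u \<in> T" for u
  proof (cases "u \<in> U")
    case True
    then obtain f y where f: "f \<in> C" "(u, f) \<in> (inner_edges C)\<^sup>*" "y \<in> nb f" "y \<notin> insert v C"
      unfolding U_def outward_def by blast
    have fX: "f \<notin> X"
    proof
      assume "f \<in> X"
      then have "nb f \<subseteq> insert v C" using nb_not_outward(1)[of f C v] X by auto
      then show False using f by blast
    qed
    show ?thesis
    proof (cases "f \<in> T")
      case False
      then have "f \<in> R" using f CV by (auto simp: R_def)
      then show ?thesis using path f by blast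
    next
      case True
      then have y: "y \<in> S - {v}" using f by (auto simp: T_def)
      \<comment> \<open>An old vertex other than \<open>v\<close> with a neighbour in
        \<open>C\<close> stays incomplete, so \<open>y\<close> can absorb the correction.\<close>
      have "\<not> nb y \<subseteq> S \<union> C" using others[of y] y f nb_sym by blast
      then have "y \<in> R" using y CV by (auto simp: R_def T_def)
      moreover have "(f, y) \<in> {(x, y). {x, y} \<in> M}" using f y by (auto simp: M_def nb_def)
      ultimately show ?thesis using path[OF f(2)] by (meson rtrancl.rtrancl_into_rtrancl)
    qed
  next
    case False
    then have "u \<in> C - outward v C" using u by (auto simp: T_def U_def)
    then obtain w where w: "w \<in> X" "(u, w) \<in> (inner_edges C)\<^sup>*" using X(2) by blast
    then have "w \<in> R" using XC CV by (auto simp: R_def T_def)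
    then show ?thesis using path w by blast
  qed
  have "\<exists>h. (\<forall>e. e \<notin> M \<longrightarrow> h e = 0) \<and> (\<forall>y. y \<notin> R \<longrightarrow> edge_sum h y = (if y \<in> T then b y - edge_sum c0 y else 0))"
    by (rule prescribe_edge_sums) (use reach CV M_def T_def in auto)
  then obtain h where h: "\<And>e. e \<notin> M \<Longrightarrow> h e = 0" "\<And>y. y \<notin> R \<Longrightarrow> edge_sum h y = (if y \<in> T then b y - edge_sum c0 y else 0)"
    by blast
  define c' where "c' e = (c0 e + h e) mod ?n" for e
  have c_mod: "c e mod ?n = c e" for e using c_range[of e] by simp
  have sg: "sig c' x = (edge_sum c0 x + edge_sum h x) mod ?n" for x unfolding c'_def sig_mod edge_sum_add ..
  have agree: "c' e = c e" if "e \<subseteq> S" for e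
  proof -
    have "e \<notin> M" "c0 e = c e" using that CV by (auto simp: M_def c0_def)
    then show ?thesis using h(1) c_mod by (simp add: c'_def)
  qed
  have outside: "c' e = 0" if "\<not> e \<subseteq> S \<union> C" for e
  proof -
    have "e \<notin> M" "c0 e = c e" using that v by (auto simp: M_def c0_def)
    moreover have "c e = 0" using that by (intro c_out) auto
    ultimately show ?thesis using h(1) by (simp add: c'_def)
  qed
  have cv: "c' {v, u} = a u" if "u \<in> C" for u
  proof -
    have "{v, u} \<notin> M" using CV by (auto simp: M_def)
    then show ?thesis using h(1) c0v[OF that] a(1)[OF that] by (simp add: c'_def)
  qed
  have sigT: "sig c' u = b u" if "u \<in> T" for u
  proof -
    have "u \<notin> R" using that by (simp add: R_def)
    then show ?thesis using sg[of u] h(2) that b by auto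
  qed
  have sigv: "sig c' v = (edge_sum c v + (\<Sum>u\<in>C. a u)) mod ?n"
  proof -
    have "edge_sum c' v = edge_sum c v + (\<Sum>u\<in>C. a u)"
      using edge_sum_extend[of c' v] agree v C cv by (metis (no_types, lifting) sum.cong)
    then show ?thesis by (simp add: sig_def)
  qed
  have av: "crit u" if "avoids c' (S \<union> C) u" "u \<in> C" for u
    using that cv[of u] C nb_sym[of v u] v by (auto simp: avoids_def crit_def insert_commute)
  have only_v: "t = v" if "t \<in> S" "\<not> nb t \<subseteq> S" "nb t \<subseteq> S \<union> C" for t
    using others[OF that(1)] that by blast
  have "partial_labeling V E r k \<rho> (S \<union> C) c' (\<lambda>u. if u \<in> C then K' u else K u)"
  proof (rule extend)
    show "C \<subseteq> V" "C \<inter> S = {}" using CV by auto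
    show "nb u \<inter> S \<noteq> {}" if "u \<in> C" for u using that C v nb_sym by blast
    show "c' e \<in> {0..<?n}" for e unfolding c'_def by (rule mod_range)
    show "c' e = c e" if "e \<subseteq> S" for e by (rule agree[OF that])
    show "c' e = 0" if "\<not> e \<subseteq> S \<union> C" for e by (rule outside[OF that])
    show "u \<in> K' u" "K' u \<subseteq> C" if "u \<in> C" for u by (fact K'_props(1)[OF that], fact K'_props(2)[OF that])
    show "K' u' = K' u" if "u \<in> C" "u' \<in> K' u" for u u' by (rule K'_props(3)[OF that])
    show "sig c' t \<noteq> sig c' t'" if "t \<in> S" "\<not> nb t \<subseteq> S" "nb t \<subseteq> S \<union> C" "t' \<in> K t" "t' \<noteq> t" "nb t' \<subseteq> S \<union> C" for t t'
    proof -
      have t: "t = v" using only_v that by blast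
      have t': "t' \<in> S" using that K_sub by blast
      have f: "nb t' \<subseteq> S" using only_v[of t'] t t' that by blast
      then have "sig c' t' = sig c t'" using sig_finished agree t' by blast
      then show ?thesis using sum(1)[of t'] that t f sigv by simp
    qed
    show "sig c' t \<noteq> \<rho>" if "t \<in> S" "t \<noteq> r" "\<not> nb t \<subseteq> S" "nb t \<subseteq> S \<union> C" "avoids c S t" for t
    proof -
      have "t = v" using only_v that by blast
      then show ?thesis using sum(2) that sigv by simp
    qed
    show "sig c' u \<noteq> sig c' u'" if u: "u \<in> C" "nb u \<subseteq> S \<union> C" "u' \<in> K' u" "u' \<noteq> u" "nb u' \<subseteq> S \<union> C" for u u'
    proof -
      have "u \<notin> X" using u by (auto simp: K'_def)
      moreover have "u' \<notin> X" using u calculation disj by (auto simp: K'_def split: if_splits)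
      moreover have "u' \<in> C" using K'_props(2) u by blast
      ultimately have "u \<in> T" "u' \<in> T" using u by (auto simp: T_def)
      then show ?thesis using sigT b u by auto
    qed
    show "sig c' u \<noteq> \<rho>" if u: "u \<in> C" "nb u \<subseteq> S \<union> C" "avoids c' (S \<union> C) u" for u
    proof -
      have cr: "crit u" using av u by blast
      then have "u \<notin> X" using X(4) by (auto simp: crit_def)
      then have "u \<in> T" using u by (simp add: T_def)
      then show ?thesis using sigT b cr by auto
    qed
    show "card (K' u) + of_bool (avoids c' (S \<union> C) u) \<le> (if u \<in> nb r then k + 1 else k)"
      if u: "u \<in> C" "\<not> nb u \<subseteq> S \<union> C" for u
    proof -
      have "\<not> nb u \<subseteq> insert v C" using u v by auto
      then have uU: "u \<in> U" "u \<notin> X" using u Xfin unfolding U_def outward_def by blast+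
      then have "card (K' u) + of_bool (crit u) \<le> (if u \<in> nb r then k + 1 else k)"
        using rows(1)[of u] unfolding K'_def U_def crit_def by simp
      moreover have "of_bool (avoids c' (S \<union> C) u) \<le> (of_bool (crit u) :: nat)" using av u by auto
      ultimately show ?thesis by linarith
    qed
    show "\<forall>u\<in>C. \<phi> u = u"
      if c'': "\<And>e. e \<subseteq> S \<union> C \<Longrightarrow> c'' e = c' e" and \<phi>: "label_aut c'' \<phi>" and fx: "\<And>u. u \<in> S \<Longrightarrow> \<phi> u = u"
        and inj: "\<And>u u'. u \<in> C \<Longrightarrow> u' \<in> K' u \<Longrightarrow> u' \<noteq> u \<Longrightarrow> sig c'' u \<noteq> sig c'' u'" for c'' \<phi>
    proof -
      have vV: "v \<in> V" using v S_sub by blast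
      have \<phi>in: "\<phi> x = \<phi> y \<longleftrightarrow> x = y" if "x \<in> V" "y \<in> V" for x y using label_aut_inj[OF \<phi>] that by blast
      have \<phi>C: "\<phi> u \<in> C" if "u \<in> C" for u
      proof -
        have u: "u \<in> nb v" "u \<in> V" "u \<notin> S" using that C CV by auto
        have n: "\<phi> u \<in> nb v" using label_aut_edge[OF \<phi> vV u(2)] fx v u by simp
        have "\<phi> u \<notin> S"
        proof
          assume a: "\<phi> u \<in> S"
          then have "\<phi> (\<phi> u) = \<phi> u" by (rule fx)
          then have "\<phi> u = u" using \<phi>in a S_sub u by blast
          then show False using a u by simp
        qed
        then show ?thesis using n C by simp
      qed
      have injC: "inj_on \<phi> C" using \<phi>in CV by (meson inj_onI subsetD)
      have surj: "\<phi> ` C = C" using \<phi>C injC CV by (simp add: endo_inj_surj image_subsetI)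
      have step: "(\<phi> x, \<phi> y) \<in> (inner_edges C)\<^sup>*" if "(x, y) \<in> (inner_edges C)\<^sup>*" for x y
        using that
      proof (induction rule: rtrancl_induct)
        case (step y z)
        then have "(\<phi> y, \<phi> z) \<in> inner_edges C" using \<phi>C label_aut_edge[OF \<phi>] CV unfolding inner_edges_def by blast
        then show ?case using step.IH by simp
      qed simp
      \<comment> \<open>\<open>outward v C\<close> is defined from the graph, \<open>v\<close> and
        \<open>C\<close> alone, and \<open>\<phi>\<close> preserves all three.\<close>
      have \<phi>U: "\<phi> u \<in> U" if "u \<in> U" for u
      proof -
        obtain f y where f: "u \<in> C" "f \<in> C" "(u, f) \<in> (inner_edges C)\<^sup>*" "y \<in> nb f" "y \<notin> insert v C"
          using \<open>u \<in> U\<close> unfolding U_def outward_def by blast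
        have yV: "y \<in> V" "f \<in> V" using f nb_sub CV by auto
        have "\<phi> y \<in> nb (\<phi> f)" using label_aut_edge[OF \<phi>] yV f by blast
        moreover have "\<phi> y \<notin> C"
        proof
          assume "\<phi> y \<in> C"
          then obtain x where "x \<in> C" "\<phi> y = \<phi> x" using surj by blast
          then show False using \<phi>in yV f CV by blast
        qed
        moreover have "\<phi> y \<noteq> v" using \<phi>in[of y v] fx[OF v] yV vV f by auto
        ultimately show ?thesis using \<phi>C[of u] \<phi>C[of f] step f unfolding U_def outward_def by blast
      qed
      have "\<phi> ` U = U" using \<phi>U injC UC CV
        by (meson endo_inj_surj finite_subset image_subsetI inj_on_subset)
      then have \<phi>Z: "\<phi> u \<notin> U" if "u \<in> C" "u \<notin> U" for u
        using that injC UC by (metis (no_types, lifting) imageE inj_on_eq_iff subsetD)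
      have \<phi>a: "a (\<phi> u) = a u" if "u \<in> C" for u
      proof -
        have "u \<in> nb v" using that C by blast
        then have "c'' {v, \<phi> u} = c'' {v, u}" using label_aut_label[OF \<phi>, of u v] fx v by simp
        then show ?thesis using c'' cv \<phi>C[OF that] that v by simp
      qed
      have \<phi>sig: "sig c'' (\<phi> u) = sig c'' u" if "u \<in> C" for u using label_aut_sig[OF \<phi>] that CV by blast
      have fixed: "\<phi> u = u" if "u \<in> C" "\<phi> u \<in> K' u" for u
        using inj[OF that] \<phi>sig[OF that(1)] by metis
      have fixU: "\<phi> u = u" if "u \<in> U" for u
      proof -
        have u: "u \<in> C" "u \<notin> X" using that UC disj by auto
        then show ?thesis using fixed[OF u(1)] that \<phi>U[OF that] \<phi>a[OF u(1)] by (simp add: K'_def)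
      qed
      have fixY: "\<phi> u = u" if "u \<in> Y" for u
      proof -
        have u: "u \<in> C" "u \<notin> U" "u \<notin> X" using that by (auto simp: Y_def U_def)
        have "\<phi> u \<notin> X" using a(2)[of u "\<phi> u"] that \<phi>a[OF u(1)] by (auto simp: Y_def)
        then have "\<phi> u \<in> Y" using split[OF \<phi>C[OF u(1)]] \<phi>Z[OF u(1,2)] by blast
        then show ?thesis using fixed[OF u(1)] u \<phi>a[OF u(1)] by (simp add: K'_def)
      qed
      have fixX: "\<phi> w = w" if w: "w \<in> X" for w
      proof -
        have wZ: "w \<in> C - outward v C" "w \<in> C" "w \<notin> U" using X(1) w XC by (auto simp: U_def)
        \<comment> \<open>The minimum degree gives \<open>w\<close> a neighbour besides
          \<open>v\<close>. It lies in the component of \<open>w\<close> and in \<open>Y\<close>,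
          hence is already fixed; so \<open>\<phi>\<close> preserves this component, whose only
          representative is \<open>w\<close>.\<close>
        have "\<not> nb w \<subseteq> {v}" using min_deg[of w] wZ CV card_mono[of "{v}" "nb w"] by auto
        then obtain z where z: "z \<in> nb w" "z \<noteq> v" by blast
        then have zC: "z \<in> C" using nb_not_outward(1)[OF wZ(1)] by blast
        have z2: "z \<in> C - outward v C" "(w, z) \<in> (inner_edges C)\<^sup>*" using nb_not_outward(2)[OF wZ(1) z(1) zC] by auto
        have "z \<notin> X" using X(3)[OF w _ z2(2)] z(1) nb_irrefl by blast
        then have "z \<in> Y" using z2 by (simp add: Y_def)
        then have "\<phi> z = z" by (rule fixY)
        have "\<phi> w \<in> X"
        proof (rule ccontr)
          assume "\<phi> w \<notin> X"
          then have "\<phi> w \<in> Y" using split[OF \<phi>C[OF wZ(2)]] \<phi>Z[OF wZ(2,3)] by blast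
          then have "\<phi> (\<phi> w) = \<phi> w" by (rule fixY)
          then have "\<phi> w = w" using \<phi>in[of "\<phi> w" w] \<phi>C[OF wZ(2)] wZ(2) CV by blast
          then show False using \<open>\<phi> w \<notin> X\<close> w by simp
        qed
        moreover have "(w, \<phi> w) \<in> (inner_edges C)\<^sup>*"
          using z2(2) inner_edges_sym[OF step[OF z2(2)]] \<open>\<phi> z = z\<close> by simp
        ultimately show ?thesis using X(3)[OF w] by metis
      qed
      show "\<forall>u\<in>C. \<phi> u = u" using split fixU fixY fixX by blast
    qed
  qed
  then show ?thesis using agree sigv cv by blast
qed

text \<open>It remains to choose the labels at \<open>v\<close>: they must give \<open>v\<close> an
  admissible sum, keep the rows short and reserve a label \<open>e\<close> for the representatives.
  The outward vertices absorb the sum if there are any; otherwise \<open>Y\<close> has to do it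
  without using \<open>e\<close>.\<close>

lemma expand_single:
  assumes v: "v \<in> S" "v \<noteq> r" and C: "C = nb v - S" "C \<noteq> {}" and nr: "nb r \<subseteq> S"
    and others: "\<And>t. t \<in> S \<Longrightarrow> t \<noteq> v \<Longrightarrow> nb t \<inter> C \<noteq> {} \<Longrightarrow> \<not> nb t \<subseteq> S \<union> C"
  shows "\<exists>c' K'. partial_labeling V E r k \<rho> (S \<union> C) c' K' \<and> (\<forall>e. e \<subseteq> S \<longrightarrow> c' e = c e)"
proof -
  let ?n = "int k + 1"
  define U where "U = outward v C"
  define Z where "Z = C - U"
  have CV: "C \<subseteq> V" "C \<inter> S = {}" "finite C" "v \<notin> C" using C v nb_sub by auto
  have fin: "finite U" "finite Z" "U \<subseteq> C" using CV by (auto simp: U_def Z_def outward_def intro: finite_subset)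
  obtain y where y: "y \<in> nb v" "y \<in> S" using parent[OF v] by blast
  have deg_v: "card C + 1 \<le> card (nb v)"
  proof -
    have "card (insert y C) \<le> card (nb v)" using y C CV by (intro card_mono) auto
    then show ?thesis using y C CV by simp
  qed
  have deg_vr: "card (nb v) \<le> card (nb r)" using v S_sub max_deg by blast
  have Cle: "card C \<le> k\<^sup>2 - 1" using deg_v deg_vr max_deg_le by linarith
  \<comment> \<open>The neighbours of \<open>w\<close> lie among \<open>v\<close> and the rest of
    \<open>C\<close>, so its degree is at most \<open>card C\<close>, whereas \<open>v\<close> has a
    further neighbour in \<open>S\<close>.\<close>
  have degZ: "card (nb w) \<noteq> card (nb r)" if "w \<in> Z" for w
  proof -
    have "nb w \<subseteq> insert v (C - {w})" using nb_not_outward(1)[of w C v] that by (auto simp: Z_def U_def)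
    then have "card (nb w) \<le> card (insert v (C - {w}))" using CV by (intro card_mono) auto
    also have "\<dots> \<le> card C" using that CV by (simp add: Z_def card_insert_if)
       (metis Suc_pred card_gt_0_iff empty_iff order_refl)
    finally show ?thesis using deg_v deg_vr by simp
  qed
  have "\<exists>w\<in>Z. (u, w) \<in> (inner_edges C)\<^sup>* \<and> True" if "u \<in> Z" for u using that by blast
  from ex_representatives[OF this] obtain X where X: "X \<subseteq> Z"
    "\<And>u. u \<in> Z \<Longrightarrow> \<exists>w\<in>X. (u, w) \<in> (inner_edges C)\<^sup>*"
    "\<And>w w'. w \<in> X \<Longrightarrow> w' \<in> X \<Longrightarrow> (w, w') \<in> (inner_edges C)\<^sup>* \<Longrightarrow> w = w'"
    by auto
  define Y where "Y = Z - X"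
  have fXY: "finite X" "finite Y" using X fin by (auto simp: Y_def intro: finite_subset)
  have Cpart: "C = U \<union> (X \<union> Y)" "U \<inter> (X \<union> Y) = {}" "X \<inter> Y = {}" using X fin by (auto simp: Y_def Z_def)
  have cards: "card C = card U + (card X + card Y)"
    by (subst Cpart(1)) (use Cpart(2,3) fin fXY in \<open>simp add: card_Un_disjoint\<close>)
  have near: "\<exists>z\<in>Y. (w, z) \<in> (inner_edges C)\<^sup>*" if w: "w \<in> X" for w
  proof -
    have wZ: "w \<in> C - outward v C" "w \<in> V" using w X CV by (auto simp: Z_def U_def)
    have "\<not> nb w \<subseteq> {v}" using min_deg[OF wZ(2)] card_mono[of "{v}" "nb w"] by auto
    then obtain z where z: "z \<in> nb w" "z \<noteq> v" by blast
    then have "z \<in> C" using nb_not_outward(1)[OF wZ(1)] by blast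
    then have z2: "z \<in> Z" "(w, z) \<in> (inner_edges C)\<^sup>*" using nb_not_outward(2)[OF wZ(1) z(1)] by (auto simp: Z_def U_def)
    then have "z \<notin> X" using X(3)[OF w] z(1) nb_irrefl by blast
    then show ?thesis using z2 by (auto simp: Y_def)
  qed
  have "{v} \<subseteq> S - {r}" "\<And>t. t \<in> {v} \<Longrightarrow> \<not> nb t \<subseteq> S" using v C by auto
  then obtain g where g: "valid_sums {v} g" using ex_valid_sums by blast
  then have gv: "g v \<in> {0..<?n}" "avoids c S v \<Longrightarrow> g v \<noteq> \<rho>" "\<And>t'. t' \<in> K v \<Longrightarrow> nb t' \<subseteq> S \<Longrightarrow> g v \<noteq> sig c t'"
    by (auto simp: valid_sums_def)
  define x where "x = g v - edge_sum c v"
  \<comment> \<open>Rows in \<open>Y\<close> may have \<open>k + 1\<close> elements, as these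
    vertices are completed at once and lack maximum degree. Rows in \<open>U\<close> must leave two
    residues for later steps.\<close>
  have "\<exists>a e. (\<forall>u\<in>C. a u \<in> {0..<?n}) \<and> (\<forall>u\<in>X. a u = e) \<and> (\<forall>u\<in>Y. a u \<noteq> e) \<and> (\<Sum>u\<in>C. a u) mod ?n = x mod ?n \<and>
    (\<forall>j. card {u \<in> U. a u = j} \<le> k - 1 \<or> j = 0 \<and> card U = k\<^sup>2 - 1 \<and> card {u \<in> U. a u = j} \<le> k) \<and>
    (\<forall>j. card {u \<in> Y. a u = j} \<le> k + 1)"
  proof -
    have build: ?thesis if aU: "\<And>u. u \<in> U \<Longrightarrow> aU u \<in> {0..<?n}" and aY: "\<And>u. u \<in> Y \<Longrightarrow> aY u \<in> {0..<?n} \<and> aY u \<noteq> e"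
      and e: "e \<in> {0..<?n}" and s: "((\<Sum>u\<in>U. aU u) + (int (card X) * e + (\<Sum>u\<in>Y. aY u))) mod ?n = x mod ?n"
      and rU: "\<And>j. card {u \<in> U. aU u = j} \<le> k - 1 \<or> j = 0 \<and> card U = k\<^sup>2 - 1 \<and> card {u \<in> U. aU u = j} \<le> k"
      and rY: "\<And>j. card {u \<in> Y. aY u = j} \<le> k + 1" for aU aY e
    proof -
      define a where "a u = (if u \<in> U then aU u else if u \<in> X then e else aY u)" for u
      have aU': "a u = aU u" if "u \<in> U" for u using that by (simp add: a_def)
      have aX': "a u = e" if "u \<in> X" for u using that Cpart by (auto simp: a_def)
      have aY': "a u = aY u" if "u \<in> Y" for u using that Cpart by (auto simp: a_def)
      have "(\<Sum>u\<in>C. a u) = (\<Sum>u\<in>U. a u) + ((\<Sum>u\<in>X. a u) + (\<Sum>u\<in>Y. a u))"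
        by (subst Cpart(1)) (use Cpart(2,3) fin fXY in \<open>simp add: sum.union_disjoint\<close>)
      also have "\<dots> = (\<Sum>u\<in>U. aU u) + (int (card X) * e + (\<Sum>u\<in>Y. aY u))" using aU' aX' aY' by simp
      finally have s': "(\<Sum>u\<in>C. a u) mod ?n = x mod ?n" using s by simp
      have "{u \<in> U. a u = j} = {u \<in> U. aU u = j}" "{u \<in> Y. a u = j} = {u \<in> Y. aY u = j}" for j
        using aU' aY' by auto
      then show ?thesis using s' aU aY e rU rY aU' aX' aY' Cpart(1) by (intro exI[of _ a] exI[of _ e]) auto
    qed
    show ?thesis
    proof (cases "U = {}")
      case False
      have "card Y \<le> k * (k + 1)" using cards Cle by (simp add: power2_eq_square)
      moreover have "1 \<le> k" using k2 by simp
      ultimately obtain aY :: "'a \<Rightarrow> int" where aY: "\<And>u. u \<in> Y \<Longrightarrow> aY u \<in> {1..int k}" "\<And>j. card {u \<in> Y. aY u = j} \<le> k + 1"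
        using rows_values[OF _ fXY(2)] by metis
      have "card U \<le> k\<^sup>2 - 1" using cards Cle by simp
      from balanced_values[OF k2 fin(1) False this, of "x - (\<Sum>u\<in>Y. aY u)"]
      obtain aU :: "'a \<Rightarrow> int" where aU: "\<forall>u\<in>U. aU u \<in> {0..<?n}"
        "(\<Sum>u\<in>U. aU u) mod ?n = (x - (\<Sum>u\<in>Y. aY u)) mod ?n"
        "\<forall>j. card {u \<in> U. aU u = j} \<le> k - 1 \<or> j = 0 \<and> card U = k\<^sup>2 - 1 \<and> card {u \<in> U. aU u = j} \<le> k"
        by (elim exE conjE)
      have s: "((\<Sum>u\<in>U. aU u) + (\<Sum>u\<in>Y. aY u)) mod ?n = x mod ?n"
        using aU(2) by (metis diff_add_cancel mod_add_left_eq)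
      show ?thesis
      proof (rule build[of aU aY 0])
        show "aU u \<in> {0..<?n}" if "u \<in> U" for u using aU(1) that by blast
        show "aY u \<in> {0..<?n} \<and> aY u \<noteq> 0" if "u \<in> Y" for u using aY(1)[OF that] by auto
        show "0 \<in> {0..<?n}" by simp
        show "(sum aU U + (int (card X) * 0 + sum aY Y)) mod ?n = x mod ?n" using s by simp
        show "card {u \<in> U. aU u = j} \<le> k - 1 \<or> j = 0 \<and> card U = k\<^sup>2 - 1 \<and> card {u \<in> U. aU u = j} \<le> k" for j
          using aU(3) by (rule spec)
        show "card {u \<in> Y. aY u = j} \<le> k + 1" for j by (rule aY(2))
      qed
    next
      case True
      then have "Z \<noteq> {}" using C(2) Cpart(1) by (auto simp: Z_def)
      then have Xne: "X \<noteq> {}" using X(2) by blast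
      then have Yne: "Y \<noteq> {}" using near by blast
      have cXY: "card X \<ge> 1" "card Y \<ge> 1" using Xne Yne fXY by (simp_all add: Suc_leI card_gt_0_iff)
      show ?thesis
      proof (cases "card Y = 1")
        case False
        \<comment> \<open>\<open>X\<close> is nonempty and uses up at least one of the
          \<open>k\<^sup>2 - 1\<close> places.\<close>
        then have "2 \<le> card Y" "card Y \<le> k\<^sup>2 - 2" using cXY cards Cle by auto
        then obtain aY :: "'a \<Rightarrow> int" where aY: "\<And>u. u \<in> Y \<Longrightarrow> aY u \<in> {1..int k}" "\<And>j. card {u \<in> Y. aY u = j} \<le> k + 1"
          "(\<Sum>u\<in>Y. aY u) mod ?n = x mod ?n"
          using rows_values_sum[OF k2 fXY(2), of x] by blast
        show ?thesis
        proof (rule build[of "\<lambda>_. 0" aY 0])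
          show "aY u \<in> {0..<?n} \<and> aY u \<noteq> 0" if "u \<in> Y" for u using aY(1)[OF that] by auto
          show "((\<Sum>u\<in>U. 0) + (int (card X) * 0 + sum aY Y)) mod ?n = x mod ?n" using aY(3) by simp
          show "card {u \<in> Y. aY u = j} \<le> k + 1" for j by (rule aY(2))
        qed (use True in simp_all)
      next
        case c1: True
        then obtain z where z: "Y = {z}" by (auto simp: card_1_singleton_iff)
        have "w = w'" if "w \<in> X" "w' \<in> X" for w w'
        proof -
          have "(w, z) \<in> (inner_edges C)\<^sup>*" "(w', z) \<in> (inner_edges C)\<^sup>*" using near that z by auto
          then have "(w, w') \<in> (inner_edges C)\<^sup>*" by (meson inner_edges_sym rtrancl_trans)
          then show ?thesis using X(3) that by blast
        qed
        then have "card X \<le> 1" using fXY by (simp add: card_le_Suc0_iff_eq)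
        then have X1: "card X = 1" using cXY by simp
        \<comment> \<open>\<open>C\<close> has just two vertices, which need distinct labels with
          sum \<open>x\<close>. If both \<open>e = 0\<close> and \<open>e = 1\<close> failed,
          \<open>k + 1\<close> would divide 2.\<close>
        have "\<exists>e\<in>{0, 1}. (x - e) mod ?n \<noteq> e"
        proof (rule ccontr)
          assume "\<not> ?thesis"
          then have e: "(x - 0) mod ?n = 0" "(x - 1) mod ?n = 1" by auto
          then have "?n dvd x" "?n dvd x - 2" using mod_eq_dvd_iff[of "x - 1" ?n 1] k2 by auto
          then have "?n dvd x - (x - 2)" by (rule dvd_diff)
          then have "?n dvd 2" by simp
          then show False using k2 by (simp add: zdvd_not_zless)
        qed
        then obtain e where e: "e \<in> {0, 1}" "(x - e) mod ?n \<noteq> e" by blast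
        show ?thesis
        proof (rule build[of "\<lambda>_. 0" "\<lambda>_. (x - e) mod ?n" e])
          show "((\<Sum>u\<in>U. 0) + (int (card X) * e + (\<Sum>u\<in>Y. (x - e) mod ?n))) mod ?n = x mod ?n"
            using X1 z by (simp add: mod_add_right_eq)
          show "card {u \<in> Y. (x - e) mod ?n = j} \<le> k + 1" for j
            using card_mono[of Y "{u \<in> Y. (x - e) mod ?n = j}"] fXY c1 by auto
        qed (use e k2 True mod_range in auto)
      qed
    qed
  qed
  then obtain a e where a: "\<And>u. u \<in> C \<Longrightarrow> a u \<in> {0..<?n}" "\<And>u. u \<in> X \<Longrightarrow> a u = e" "\<And>u. u \<in> Y \<Longrightarrow> a u \<noteq> e"
    "(\<Sum>u\<in>C. a u) mod ?n = x mod ?n"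
    "\<And>j. card {u \<in> U. a u = j} \<le> k - 1 \<or> j = 0 \<and> card U = k\<^sup>2 - 1 \<and> card {u \<in> U. a u = j} \<le> k"
    "\<And>j. card {u \<in> Y. a u = j} \<le> k + 1"
    by blast
  have target: "(edge_sum c v + (\<Sum>u\<in>C. a u)) mod ?n = g v"
  proof -
    have "(edge_sum c v + (\<Sum>u\<in>C. a u)) mod ?n = (edge_sum c v + x) mod ?n" using a(4) by (metis mod_add_right_eq)
    then show ?thesis using gv(1) by (simp add: x_def)
  qed
  have "\<exists>c' K'. partial_labeling V E r k \<rho> (S \<union> C) c' K' \<and> (\<forall>e. e \<subseteq> S \<longrightarrow> c' e = c e) \<and>
    sig c' v = (edge_sum c v + (\<Sum>u\<in>C. a u)) mod ?n \<and> (\<forall>u\<in>C. c' {v, u} = a u)"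
  proof (rule expand[where X = X])
    show "v \<in> S" "C = nb v - S" by (fact v(1), fact C(1))
    show "\<not> nb t \<subseteq> S \<union> C" if "t \<in> S" "t \<noteq> v" "nb t \<inter> C \<noteq> {}" for t using others that by blast
    show "X \<subseteq> C - outward v C" using X(1) by (simp add: Z_def U_def)
    show "\<exists>w\<in>X. (u, w) \<in> (inner_edges C)\<^sup>*" if "u \<in> C - outward v C" for u using X(2) that by (simp add: Z_def U_def)
    show "w = w'" if "w \<in> X" "w' \<in> X" "(w, w') \<in> (inner_edges C)\<^sup>*" for w w' by (rule X(3)[OF that])
    show "card (nb w) \<noteq> card (nb r)" if "w \<in> X" for w using degZ X(1) that by blast
    show "a u \<in> {0..<?n}" if "u \<in> C" for u by (rule a(1)[OF that])
    show "a u \<noteq> a w" if "u \<in> C - outward v C - X" "w \<in> X" for u w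
      using a(2)[OF that(2)] a(3)[of u] that by (simp add: Y_def Z_def U_def)
    show "(edge_sum c v + sum a C) mod ?n \<noteq> sig c t'" if "t' \<in> K v" "nb t' \<subseteq> S" for t'
      unfolding target by (rule gv(3)[OF that])
    show "(edge_sum c v + sum a C) mod ?n \<noteq> \<rho>" if "avoids c S v"
      unfolding target by (rule gv(2)[OF that])
    show "card {u' \<in> outward v C. a u' = a u} +
        of_bool (card (nb u) = card (nb r) \<and> \<not> (a u = 0 \<and> card (nb v) = card (nb r))) \<le> (if u \<in> nb r then k + 1 else k)"
      if "u \<in> outward v C" for u
    proof -
      consider "card {u' \<in> U. a u' = a u} \<le> k - 1" | "a u = 0" "card U = k\<^sup>2 - 1" "card {u' \<in> U. a u' = a u} \<le> k"
        using a(5)[of "a u"] by blast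
      then show ?thesis
      proof cases
        case 1
        then show ?thesis using k2 by (auto simp: U_def)
      next
        case 2
        \<comment> \<open>The value \<open>card U = k\<^sup>2 - 1\<close> forces \<open>v\<close> to
          have maximum degree. An edge to \<open>v\<close> labeled 0 then lifts the need to avoid
          \<open>\<rho>\<close>, so a row of \<open>k\<close> is still admissible.\<close>
        have "k\<^sup>2 \<ge> 1" using k2 by simp
        then have "card (nb v) = card (nb r)" using 2(2) cards deg_v deg_vr max_deg_le by linarith
        then show ?thesis using 2 by (auto simp: U_def)
      qed
    qed
    show "card {u' \<in> C - outward v C - X. a u' = a u} +
        of_bool (card (nb u) = card (nb r) \<and> \<not> (a u = 0 \<and> card (nb v) = card (nb r))) \<le> k + 1"
      if "u \<in> C - outward v C - X" for u
      using a(6)[of "a u"] degZ[of u] that by (auto simp: Y_def Z_def U_def)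
  qed
  then show ?thesis by blast
qed

end

section \<open>The root step and growth to the whole graph\<close>

context rooted_graph
begin

text \<open>Label 0 goes only to the representatives \<open>X\<close>, chosen without maximum
  degree, and this gives the mark of the root. The at most \<open>k\<^sup>2\<close> other neighbours
  fill \<open>k\<close> rows of size at most \<open>k\<close>; together with \<open>\<rho>\<close>
  this explains the bound \<open>k + 1\<close> in \<open>slack\<close> for neighbours of
  \<open>r\<close>.\<close>

lemma root_step:
  assumes no_twins: "\<And>w. w \<in> V \<Longrightarrow> w \<noteq> r \<Longrightarrow> \<exists>u\<in>V - {r, w}. \<not> (u \<in> nb r \<and> u \<in> nb w)"
  shows "\<exists>\<rho> c K. partial_labeling V E r k \<rho> (insert r (nb r)) c K \<and> sig c r = \<rho> \<and>
    (\<forall>y\<in>nb r. card (nb y) = card (nb r) \<longrightarrow> c {r, y} \<noteq> 0)"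
proof -
  let ?n = "int k + 1"
  define C where "C = nb r"
  define Z where "Z = C - outward r C"
  have fin: "finite C" "r \<notin> C" by (auto simp: C_def)
  have reps: "\<exists>w\<in>Z. (u, w) \<in> (inner_edges C)\<^sup>* \<and> card (nb w) \<noteq> card (nb r)" if u: "u \<in> Z" for u
  proof (rule ccontr)
    \<comment> \<open>A closed component consisting of vertices of maximum degree would have to be
      all of \<open>C\<close>; the graph would then be complete, which \<open>no_twins\<close>
      excludes.\<close>
    assume neg: "\<not> ?thesis"
    define L where "L = {w. (u, w) \<in> (inner_edges C)\<^sup>*}"
    have LC: "L \<subseteq> C" using inner_edges_closed u by (auto simp: L_def Z_def)
    have LZ: "x \<in> Z" if "x \<in> L" for x
      using that outward_step[of u x C r] u LC by (auto simp: L_def Z_def)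
    have nbL: "nb x \<subseteq> insert r (L - {x})" if x: "x \<in> L" for x
    proof
      fix y assume y: "y \<in> nb x"
      have xZ: "x \<in> C - outward r C" using LZ[OF x] by (simp add: Z_def)
      show "y \<in> insert r (L - {x})"
      proof (cases "y = r")
        case False
        then have "y \<in> C" using nb_not_outward(1)[OF xZ] y by blast
        then have "(x, y) \<in> (inner_edges C)\<^sup>*" using nb_not_outward(2)[OF xZ y] by blast
        then have "y \<in> L" using x by (auto simp: L_def)
        then show ?thesis using y by auto
      qed simp
    qed
    have uL: "u \<in> L" by (simp add: L_def)
    have finL: "finite L" using LC fin finite_subset by blast
    have cardL: "card (insert r (L - {x})) = card L" if "x \<in> L" for x
    proof -
      have "r \<notin> L - {x}" using LC fin by blast
      then have "card (insert r (L - {x})) = Suc (card (L - {x}))" using finL by simp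
      then show ?thesis using card_Suc_Diff1[OF finL that] by simp
    qed
    have full: "card (nb x) = card C" if "x \<in> L" for x using neg LZ[OF that] that by (auto simp: L_def C_def)
    have "card C \<le> card L" using card_mono[OF _ nbL[OF uL]] full[OF uL] cardL[OF uL] finL by simp
    then have LeqC: "L = C" using LC fin by (simp add: card_seteq)
    have nbx: "nb x = insert r (C - {x})" if "x \<in> C" for x
      using nbL[of x] full[of x] cardL[of x] that LeqC fin by (metis card_subset_eq finite_Diff finite_insert)
    have "insert r C = V"
      by (rule closed_eq_V[of _ r]) (use r_V nb_sub nbx C_def in auto)
    then have "\<forall>x\<in>V - {r, u}. x \<in> nb r \<and> x \<in> nb u" using nbx[of u] uL LeqC by (auto simp: C_def)
    moreover have "u \<in> V" "u \<noteq> r" using uL LC nb_sub fin by (auto simp: C_def)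
    ultimately show False using no_twins by blast
  qed
  from ex_representatives[OF reps] obtain X where X: "X \<subseteq> Z" "\<And>u. u \<in> Z \<Longrightarrow> \<exists>w\<in>X. (u, w) \<in> (inner_edges C)\<^sup>*"
    "\<And>w w'. w \<in> X \<Longrightarrow> w' \<in> X \<Longrightarrow> (w, w') \<in> (inner_edges C)\<^sup>* \<Longrightarrow> w = w'"
    "\<And>w. w \<in> X \<Longrightarrow> card (nb w) \<noteq> card (nb r)"
    by auto
  have "card (C - X) \<le> k * k"
    using card_mono[of C "C - X"] fin max_deg_le by (auto simp: C_def power2_eq_square)
  moreover have "1 \<le> k" "finite (C - X)" using k2 fin by simp_all
  ultimately obtain a0 :: "'a \<Rightarrow> int" where a0: "\<And>u. u \<in> C - X \<Longrightarrow> a0 u \<in> {1..int k}" "\<And>j. card {u \<in> C - X. a0 u = j} \<le> k"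
    using rows_values[of k "C - X" k] by metis
  define a where "a u = (if u \<in> X then 0 else a0 u)" for u
  define \<rho> where "\<rho> = (\<Sum>u\<in>C. a u) mod ?n"
  interpret partial_labeling V E r k \<rho> "{r}" "\<lambda>_. 0" "\<lambda>_. {r}"
  proof
    show "rigid {r} (\<lambda>_. 0) (\<lambda>_. {r})" by (auto simp: rigid_def)
  qed (use r_V in auto)
  have sub: "card {u' \<in> W. a u' = a u} \<le> k" if "W \<subseteq> C - X" for W u
  proof -
    have "card {u' \<in> W. a u' = a u} \<le> card {u' \<in> C - X. a0 u' = a u}"
      using that fin by (intro card_mono) (auto simp: a_def)
    then show ?thesis using a0(2)[of "a u"] by linarith
  qed
  have "\<exists>c' K'. partial_labeling V E r k \<rho> ({r} \<union> C) c' K' \<and> (\<forall>e. e \<subseteq> {r} \<longrightarrow> c' e = 0) \<and>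
    sig c' r = (edge_sum (\<lambda>_. 0) r + (\<Sum>u\<in>C. a u)) mod ?n \<and> (\<forall>u\<in>C. c' {r, u} = a u)"
  proof (rule expand[where X = X])
    show "r \<in> {r}" "C = nb r - {r}" by (auto simp: C_def)
    show "X \<subseteq> C - outward r C" using X(1) by (simp add: Z_def)
    show "\<exists>w\<in>X. (u, w) \<in> (inner_edges C)\<^sup>*" if "u \<in> C - outward r C" for u using X(2) that by (simp add: Z_def)
    show "w = w'" if "w \<in> X" "w' \<in> X" "(w, w') \<in> (inner_edges C)\<^sup>*" for w w' by (rule X(3)[OF that])
    show "card (nb w) \<noteq> card (nb r)" if "w \<in> X" for w by (rule X(4)[OF that])
    show "a u \<in> {0..<?n}" if "u \<in> C" for u using a0(1)[of u] that by (auto simp: a_def)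
    show "a u \<noteq> a w" if "u \<in> C - outward r C - X" "w \<in> X" for u w using a0(1)[of u] that by (auto simp: a_def)
    show "card {u' \<in> outward r C. a u' = a u} +
        of_bool (card (nb u) = card (nb r) \<and> \<not> (a u = 0 \<and> card (nb r) = card (nb r))) \<le> (if u \<in> nb r then k + 1 else k)"
      if "u \<in> outward r C" for u
    proof -
      have "outward r C \<subseteq> C - X" using X(1) by (auto simp: outward_def Z_def)
      moreover have "u \<in> nb r" using that by (simp add: outward_def C_def)
      ultimately show ?thesis using sub[of "outward r C" u] by auto
    qed
    show "card {u' \<in> C - outward r C - X. a u' = a u} +
        of_bool (card (nb u) = card (nb r) \<and> \<not> (a u = 0 \<and> card (nb r) = card (nb r))) \<le> k + 1" for u
    proof -
      have "card {u' \<in> C - outward r C - X. a u' = a u} \<le> k" by (rule sub) auto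
      moreover have "of_bool P \<le> (1 :: nat)" for P by simp
      ultimately show ?thesis by (rule add_mono)
    qed
  qed auto
  then obtain c' K' where c': "partial_labeling V E r k \<rho> ({r} \<union> C) c' K'" "sig c' r = \<rho>" "\<And>u. u \<in> C \<Longrightarrow> c' {r, u} = a u"
    by (auto simp: \<rho>_def edge_sum_def)
  have "c' {r, y} \<noteq> 0" if "y \<in> nb r" "card (nb y) = card (nb r)" for y
  proof -
    have "y \<in> C - X" using that X(4) by (auto simp: C_def)
    then show ?thesis using c'(3)[of y] a0(1)[of y] by (auto simp: a_def)
  qed
  then show ?thesis using c'(1,2) by (auto simp: C_def)
qed

text \<open>With \<open>nb r\<close> inside \<open>S\<close> all edges at \<open>r\<close> have
  their final labels, so the mark of the root persists.\<close>

definition rooted_labeling :: "int \<Rightarrow> 'a set \<Rightarrow> ('a set \<Rightarrow> int) \<Rightarrow> ('a \<Rightarrow> 'a set) \<Rightarrow> bool" where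
  "rooted_labeling \<rho> S c K \<longleftrightarrow> partial_labeling V E r k \<rho> S c K \<and> nb r \<subseteq> S \<and> sig c r = \<rho> \<and>
     (\<forall>y\<in>nb r. card (nb y) = card (nb r) \<longrightarrow> c {r, y} \<noteq> 0)"

text \<open>If \<open>w\<close> is the only neighbour outside \<open>S\<close> of all its neighbours, has maximum degree and
  \<open>nb w \<noteq> nb r\<close>, then some neighbour of \<open>w\<close> has two admissible sums, so \<open>w\<close> can avoid \<open>\<rho>\<close>. This
  fails for a lone twin of the root, which is hence added right after the first step.\<close>

definition no_lone_twin :: "'a set \<Rightarrow> bool" where
  "no_lone_twin S \<longleftrightarrow> (\<forall>w\<in>V - S. nb w = nb r \<longrightarrow> (\<exists>w'\<in>V - S. w' \<noteq> w \<and> nb w' = nb r))"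

lemma rooted_labeling_extend:
  assumes "rooted_labeling \<rho> S c K" "partial_labeling V E r k \<rho> (S \<union> C) c' K'" "\<forall>e. e \<subseteq> S \<longrightarrow> c' e = c e"
  shows "rooted_labeling \<rho> (S \<union> C) c' K'"
proof -
  interpret partial_labeling V E r k \<rho> S c K using assms(1) by (simp add: rooted_labeling_def)
  have nr: "nb r \<subseteq> S" using assms(1) by (simp add: rooted_labeling_def)
  have "sig c' r = sig c r" using sig_finished[OF _ r_S nr, of c'] assms(3) by blast
  moreover have "c' {r, y} = c {r, y}" if "y \<in> nb r" for y using assms(3) nr r_S that by auto
  ultimately show ?thesis using assms(1,2) unfolding rooted_labeling_def by auto
qed

text \<open>Vertices with the neighbourhood of \<open>r\<close> enter a layer together, since
  \<open>v\<close> sees all of them or none. Hence \<open>no_lone_twin\<close> persists, and a layer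
  with one element is never such a vertex.\<close>

lemma rooted_labeling_step:
  assumes st: "rooted_labeling \<rho> S c K" and tw: "no_lone_twin S" and "S \<noteq> V"
  shows "\<exists>C c' K'. C \<noteq> {} \<and> C \<subseteq> V - S \<and> rooted_labeling \<rho> (S \<union> C) c' K' \<and> no_lone_twin (S \<union> C)"
proof -
  interpret partial_labeling V E r k \<rho> S c K using st by (simp add: rooted_labeling_def)
  have nr: "nb r \<subseteq> S" using st by (simp add: rooted_labeling_def)
  have "\<exists>v. v \<in> S \<and> \<not> nb v \<subseteq> S" using closed_eq_V[OF S_sub r_S] assms(3) by blast
  then obtain v where v: "v \<in> S \<and> \<not> nb v \<subseteq> S"
    "\<And>t. t \<in> S \<and> \<not> nb t \<subseteq> S \<Longrightarrow> card (nb v - S) \<le> card (nb t - S)"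
    using ex_has_least_nat[of "\<lambda>v. v \<in> S \<and> \<not> nb v \<subseteq> S" _ "\<lambda>v. card (nb v - S)"] by blast
  define C where "C = nb v - S"
  have C: "C \<noteq> {}" "C \<subseteq> V - S" "finite C" using v nb_sub by (auto simp: C_def)
  have vr: "v \<noteq> r" using v nr by blast
  have minimal: "nb t - S = C" if "t \<in> S" "\<not> nb t \<subseteq> S" "nb t \<subseteq> S \<union> C" for t
  proof -
    have "nb t - S \<subseteq> C" using that by blast
    moreover have "card C \<le> card (nb t - S)" using v(2)[of t] that by (simp add: C_def)
    ultimately show ?thesis using C(3) by (simp add: card_seteq)
  qed
  have twC: "no_lone_twin (S \<union> C)" unfolding no_lone_twin_def
  proof (intro ballI impI)
    fix w assume w: "w \<in> V - (S \<union> C)" "nb w = nb r"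
    then obtain w' where w': "w' \<in> V - S" "w' \<noteq> w" "nb w' = nb r" using tw unfolding no_lone_twin_def by blast
    have "w' \<notin> C"
    proof
      assume "w' \<in> C"
      then have "v \<in> nb w" using w' w nb_sym by (auto simp: C_def)
      then show False using w nb_sym by (auto simp: C_def)
    qed
    then show "\<exists>w'\<in>V - (S \<union> C). w' \<noteq> w \<and> nb w' = nb r" using w' by blast
  qed
  have "\<exists>c' K'. partial_labeling V E r k \<rho> (S \<union> C) c' K' \<and> (\<forall>e. e \<subseteq> S \<longrightarrow> c' e = c e)"
  proof (cases "\<exists>s\<in>S. s \<noteq> v \<and> nb s - S = C")
    case True
    then obtain s where s: "s \<in> S" "s \<noteq> v" "nb s - S = C" by blast
    show ?thesis
    proof (cases "card C \<ge> 2")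
      case True
      show ?thesis
      proof (rule absorb_common[of v s])
        show "v \<in> S" "s \<in> S" "s \<noteq> v" "C = nb v - S" "nb s - S = C" "2 \<le> card C" "nb r \<subseteq> S"
          using v(1) s C_def True nr by simp_all
        show "nb t - S = C" if "t \<in> S" "\<not> nb t \<subseteq> S" "nb t \<subseteq> S \<union> C" for t by (rule minimal[OF that])
      qed
    next
      case False
      then have "card C = 1" using C by (metis One_nat_def Suc_1 Suc_leI card_gt_0_iff le_antisym not_less_eq_eq)
      then obtain w where w: "C = {w}" by (auto simp: card_1_singleton_iff)
      then have wv: "w \<in> nb v" "w \<in> V" "w \<notin> S" "nb v - S = {w}" using C by (auto simp: C_def)
      have "\<exists>c' K'. partial_labeling V E r k \<rho> (S \<union> {w}) c' K' \<and> (\<forall>e. e \<subseteq> S \<longrightarrow> c' e = c e)"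
      proof (rule absorb)
        show "w \<in> V" "w \<notin> S" "nb w \<inter> S \<noteq> {}" using wv v nb_sym by auto
        show "nb r \<subseteq> S" by (rule nr)
        show "\<phi> w = w" if \<phi>: "label_aut c'' \<phi>" and fx: "\<And>u. u \<in> S \<Longrightarrow> \<phi> u = u" for c'' \<phi>
        proof -
          have "\<phi> w \<in> nb v" using label_aut_edge[OF \<phi>, of v w] wv v S_sub fx by auto
          moreover have "\<phi> w \<notin> S"
          proof
            assume a: "\<phi> w \<in> S"
            then have "\<phi> (\<phi> w) = \<phi> w" by (rule fx)
            then have "\<phi> w = w" using label_aut_inj[OF \<phi>] a S_sub wv by blast
            then show False using a wv by simp
          qed
          ultimately show ?thesis using wv(4) by blast
        qed
        show "(\<exists>t\<in>nb w. \<not> nb t \<subseteq> insert w S) \<or> (\<exists>t\<in>nb w. t \<notin> nb r)"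
          if "nb w \<subseteq> S" "card (nb w) = card (nb r)"
        proof (rule ccontr)
          assume "\<not> ?thesis"
          \<comment> \<open>By its degree \<open>w\<close> would have the same neighbours as
            \<open>r\<close>. A second such vertex outside \<open>S\<close> would also be adjacent
            to \<open>v\<close>, contrary to \<open>C = {w}\<close>.\<close>
          then have "nb w \<subseteq> nb r" by blast
          then have "nb w = nb r" using that(2) by (simp add: card_subset_eq)
          then obtain w' where w': "w' \<in> V - S" "w' \<noteq> w" "nb w' = nb r" using tw wv unfolding no_lone_twin_def by blast
          then have "w' \<in> nb v" using \<open>nb w = nb r\<close> wv(1) nb_sym by metis
          then show False using w' wv(4) by blast
        qed
      qed
      then show ?thesis using w by simp
    qed
  next
    case False
    show ?thesis
    proof (rule expand_single)
      show "v \<in> S" "v \<noteq> r" "C = nb v - S" "C \<noteq> {}" "nb r \<subseteq> S" using v vr C nr by (auto simp: C_def)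
      show "\<not> nb t \<subseteq> S \<union> C" if "t \<in> S" "t \<noteq> v" "nb t \<inter> C \<noteq> {}" for t
      proof
        assume "nb t \<subseteq> S \<union> C"
        moreover have "\<not> nb t \<subseteq> S" using that(3) C(2) by blast
        ultimately show False using False minimal[OF that(1)] that(1,2) by blast
      qed
    qed
  qed
  then obtain c' K' where "partial_labeling V E r k \<rho> (S \<union> C) c' K'" "\<forall>e. e \<subseteq> S \<longrightarrow> c' e = c e" by (elim exE conjE)
  then have "rooted_labeling \<rho> (S \<union> C) c' K'" by (rule rooted_labeling_extend[OF st])
  then show ?thesis using twC C(1,2) by (intro exI conjI)
qed

lemma rooted_labeling_complete:
  assumes "rooted_labeling \<rho> S c K" "no_lone_twin S"
  shows "\<exists>c K. rooted_labeling \<rho> V c K"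
  using assms
proof (induction "card (V - S)" arbitrary: S c K rule: less_induct)
  case less
  show ?case
  proof (cases "S = V")
    case True
    then show ?thesis using less.prems by blast
  next
    case False
    from rooted_labeling_step[OF less.prems False] obtain C c' K'
      where C: "C \<noteq> {}" "C \<subseteq> V - S" "rooted_labeling \<rho> (S \<union> C) c' K'" "no_lone_twin (S \<union> C)" by blast
    have "card (V - (S \<union> C)) < card (V - S)" using C finite_V by (intro psubset_card_mono) auto
    then show ?thesis using less.hyps[OF _ C(3,4)] by blast
  qed
qed

text \<open>Once \<open>S = V\<close>, all sums are final and the assumption inside
  \<open>rigid\<close> holds, so only \<open>\<phi> r = r\<close> is left. The image of
  \<open>r\<close> inherits its degree, its sum and the absence of 0 towards vertices of maximum
  degree, and \<open>finished_avoids\<close> allows this for \<open>r\<close> alone.\<close>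

lemma distinguishable_no_twins:
  assumes no_twins: "\<And>w. w \<in> V \<Longrightarrow> w \<noteq> r \<Longrightarrow> \<exists>u\<in>V - {r, w}. \<not> (u \<in> nb r \<and> u \<in> nb w)"
  shows distinguishable
proof -
  obtain \<rho> c0 K0 where base: "rooted_labeling \<rho> (insert r (nb r)) c0 K0"
    using root_step[OF no_twins] unfolding rooted_labeling_def by blast
  let ?S = "insert r (nb r)"
  interpret b: partial_labeling V E r k \<rho> ?S c0 K0 using base by (simp add: rooted_labeling_def)
  have "\<exists>S c K. rooted_labeling \<rho> S c K \<and> no_lone_twin S"
  proof (cases "no_lone_twin ?S")
    case True
    then show ?thesis using base by blast
  next
    case False
    then obtain w where w: "w \<in> V" "w \<notin> ?S" "nb w = nb r"
      and only: "\<And>w'. w' \<in> V - ?S \<Longrightarrow> nb w' = nb r \<Longrightarrow> w' = w" unfolding no_lone_twin_def by blast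
    have "nb r \<noteq> {}" using min_deg[OF r_V] by auto
    \<comment> \<open>The lone twin is fixed because its neighbourhood is unique outside
      \<open>?S\<close>. It has a neighbour that stays incomplete, as otherwise the graph would
      consist of \<open>r\<close>, \<open>w\<close> and their common neighbours.\<close>
    have "\<exists>c' K'. partial_labeling V E r k \<rho> (?S \<union> {w}) c' K' \<and> (\<forall>e. e \<subseteq> ?S \<longrightarrow> c' e = c0 e)"
    proof (rule b.absorb)
      show "w \<in> V" "w \<notin> ?S" "nb w \<inter> ?S \<noteq> {}" "nb r \<subseteq> ?S" using w \<open>nb r \<noteq> {}\<close> by auto
      show "\<phi> w = w" if \<phi>: "label_aut c'' \<phi>" and fx: "\<And>u. u \<in> ?S \<Longrightarrow> \<phi> u = u" for c'' \<phi>
      proof (rule only)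
        have "\<phi> w \<notin> ?S"
        proof
          assume a: "\<phi> w \<in> ?S"
          then have "\<phi> (\<phi> w) = \<phi> w" by (rule fx)
          then have "\<phi> w = w" using label_aut_inj[OF \<phi>] a b.S_sub w by blast
          then show False using a w by simp
        qed
        then show "\<phi> w \<in> V - ?S" using label_aut_in_V[OF \<phi> w(1)] by blast
        have "\<phi> ` nb r = nb r" using fx by force
        then show "nb (\<phi> w) = nb r" using label_aut_nb[OF \<phi> w(1)] w by simp
      qed
      show "(\<exists>t\<in>nb w. \<not> nb t \<subseteq> insert w ?S) \<or> (\<exists>t\<in>nb w. t \<notin> nb r)"
      proof (rule ccontr)
        assume "\<not> ?thesis"
        then have "\<And>t. t \<in> nb r \<Longrightarrow> nb t \<subseteq> insert w ?S" using w by blast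
        then have "insert w ?S = V"
          by (intro closed_eq_V[of _ r]) (use w r_V nb_sub in auto)
        then have "\<forall>u\<in>V - {r, w}. u \<in> nb r \<and> u \<in> nb w" using w by blast
        then show False using no_twins[of w] w by blast
      qed
    qed
    then obtain c' K' where "rooted_labeling \<rho> (?S \<union> {w}) c' K'" using rooted_labeling_extend[OF base] by blast
    moreover have "no_lone_twin (?S \<union> {w})" using only unfolding no_lone_twin_def by blast
    ultimately show ?thesis by blast
  qed
  then obtain c K where cK: "rooted_labeling \<rho> V c K" using rooted_labeling_complete by blast
  interpret partial_labeling V E r k \<rho> V c K using cK by (simp add: rooted_labeling_def)
  have mark: "sig c r = \<rho>" "\<And>y. y \<in> nb r \<Longrightarrow> card (nb y) = card (nb r) \<Longrightarrow> c {r, y} \<noteq> 0"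
    using cK by (auto simp: rooted_labeling_def)
  have "\<phi> v = v" if \<phi>: "label_aut c \<phi>" and v: "v \<in> V" for \<phi> v
  proof -
    have "\<phi> r = r"
    proof (rule ccontr)
      assume neq: "\<phi> r \<noteq> r"
      have rV: "\<phi> r \<in> V" by (rule label_aut_in_V[OF \<phi> r_V])
      have "avoids c V (\<phi> r)" unfolding avoids_def
      proof (intro conjI notI)
        show "card (nb (\<phi> r)) = card (nb r)" by (rule label_aut_degree[OF \<phi> r_V])
        assume "\<exists>y\<in>nb (\<phi> r) \<inter> V. card (nb y) = card (nb r) \<and> c {\<phi> r, y} = 0"
        then obtain y where y: "y \<in> nb (\<phi> r)" "card (nb y) = card (nb r)" "c {\<phi> r, y} = 0" by blast
        then have "y \<in> \<phi> ` nb r" using label_aut_nb[OF \<phi> r_V] by simp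
        then obtain z where z: "z \<in> nb r" "y = \<phi> z" by blast
        then have "z \<in> V" using nb_sub by blast
        then have "card (nb z) = card (nb r)" "c {r, z} = 0"
          using label_aut_degree[OF \<phi>, of z] label_aut_label[OF \<phi> z(1)] y z(2) by simp_all
        then show False using mark(2) z(1) by blast
      qed
      then have "sig c (\<phi> r) \<noteq> \<rho>" using finished_avoids[OF rV neq nb_sub] by blast
      then show False using label_aut_sig[OF \<phi> r_V] mark(1) by simp
    qed
    moreover have "\<forall>u\<in>V. \<forall>u'\<in>K u. u' \<noteq> u \<longrightarrow> sig c u \<noteq> sig c u'" using finished_distinct nb_sub by blast
    ultimately show ?thesis using rigid \<phi> v unfolding rigid_def by blast
  qed
  then show ?thesis using c_range unfolding distinguishable_def by blast
qed

lemma always_distinguishable: distinguishable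
  using distinguishable_twins distinguishable_no_twins by blast

end

theorem theorem3p4:
  fixes V :: "'a set" and E :: "'a set set"
  assumes "finite_simple_graph V E"
    and "connected_graph V E"
    and "min_degree V E \<ge> 2"
  shows "int (distinguishing_index V E) \<le> 1 + \<lceil>sqrt (real (max_degree V E))\<rceil>"
proof -
  interpret finite_graph V E by unfold_locales (rule assms(1))
  define \<Delta> where "\<Delta> = max_degree V E"
  define k where "k = nat \<lceil>sqrt (real \<Delta>)\<rceil>"
  have ne: "finite (vertex_degree E ` V)" "vertex_degree E ` V \<noteq> {}"
    using finite_V assms(2) by (auto simp: connected_graph_def)
  obtain r where r: "r \<in> V" "vertex_degree E r = \<Delta>"
    using Max_in[OF ne] by (auto simp: \<Delta>_def max_degree_def)
  have max: "card (nb u) \<le> card (nb r)" if "u \<in> V" for u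
    using Max_ge[OF ne(1)] that r(2) by (auto simp: \<Delta>_def max_degree_def vertex_degree_eq[symmetric])
  have min: "2 \<le> card (nb u)" if "u \<in> V" for u
    using Min_le[OF ne(1), of "vertex_degree E u"] that assms(3) by (auto simp: min_degree_def vertex_degree_eq[symmetric])
  have "0 \<le> sqrt (real \<Delta>)" by simp
  then have "0 \<le> \<lceil>sqrt (real \<Delta>)\<rceil>" by linarith
  then have k: "int k = \<lceil>sqrt (real \<Delta>)\<rceil>" by (simp add: k_def)
  have \<Delta>: "card (nb r) = \<Delta>" using r(2) vertex_degree_eq by simp
  have le: "sqrt (real \<Delta>) \<le> real k" using k le_of_int_ceiling[of "sqrt (real \<Delta>)"] by (metis of_int_of_nat_eq)
  then have "real \<Delta> \<le> (real k)\<^sup>2" by (metis of_nat_0_le_iff real_sqrt_le_iff real_sqrt_unique)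
  then have \<Delta>k: "\<Delta> \<le> k\<^sup>2" by (metis of_nat_le_iff of_nat_power)
  have "k \<ge> 2"
  proof (rule ccontr)
    assume "\<not> k \<ge> 2"
    then have "k\<^sup>2 \<le> 1\<^sup>2" by (intro power_mono) auto
    then show False using \<Delta>k min[OF r(1)] \<Delta> by simp
  qed
  then interpret rooted_graph V E r k
    by unfold_locales (use assms(2) min r(1) max \<Delta>k \<Delta> in auto)
  obtain c where c: "\<And>e. c e \<in> {0..<int k + 1}" "\<And>\<phi>. label_aut c \<phi> \<Longrightarrow> \<forall>v\<in>V. \<phi> v = v"
    using always_distinguishable unfolding distinguishable_def by blast
  have "distinguishing_labeling V E (\<lambda>e. nat (c e))"
    unfolding distinguishing_labeling_def
  proof (intro allI impI)
    fix \<phi> assume "graph_automorphism V E \<phi> \<and> preserves_labeling E (\<lambda>e. nat (c e)) \<phi>"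
    then have "label_aut c \<phi>" using c(1) unfolding label_aut_def preserves_labeling_def
      by (metis atLeastLessThan_iff eq_nat_nat_iff)
    then show "\<forall>v\<in>V. \<phi> v = v" by (rule c(2))
  qed
  moreover have "(\<lambda>e. nat (c e)) ` E \<subseteq> {..<k + 1}"
  proof
    fix i assume "i \<in> (\<lambda>e. nat (c e)) ` E"
    then obtain e where "i = nat (c e)" by blast
    then show "i \<in> {..<k + 1}" using c(1)[of e] by auto
  qed
  ultimately have "distinguishing_index V E \<le> k + 1"
    unfolding distinguishing_index_def by (intro Least_le) blast
  then show ?thesis using k by (simp add: \<Delta>_def)
qed

end
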